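(* Let $\{a_n\}_{n\in\mathbb{N}}$ be a sequence of complex numbers such that $$\sum_{n=1}^\infty |a_n|\, e^{-\pi n/2}<\infty .$$ Then for every $n\in\mathbb{N}$ $$a_n=\frac{2}{\pi^2}\, n\sinh(\pi n)\int_0^\infty J(x,in,\pi)\sum_{m=1}^\infty a_m K_{im}(x)\,\frac{dx}{x},$$ where the iterated series and integral converge absolutely.
   Context: $\mathbb{N}=\{1,2,\dots\}$ and $i$ is the imaginary unit. $K_\nu$ is the modified Bessel (Macdonald) function, $K_\nu(x)=\int_0^\infty e^{-x\cosh u}\cosh(\nu u)\,du$ for $x>0$, $\nu\in\mathbb{C}$; thus $K_{im}(x)=\int_0^\infty e^{-x\cosh u}\cos(mu)\,du$. The incomplete modified Bessel function is $J(z,\nu,w)=\int_0^w e^{-z\cosh u}\cosh(\nu u)\,du$; thus $J(x,in,\pi)=\int_0^\pi e^{-x\cosh u}\cos(nu)\,du$. *)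

theory Defs
  imports "HOL-Analysis.Analysis"
begin

text \<open>
  The first integral converges absolutely for every x > 0, the only range where it is meaningful.
  The second is the integral from 0 to w for w \<ge> 0 only; for w < 0 the domain is empty.
\<close>

definition macdonald_K :: "complex \<Rightarrow> real \<Rightarrow> complex" where
  "macdonald_K \<nu> x =
     (LINT u:{0..}|lborel. complex_of_real (exp (- x * cosh u)) * cosh (\<nu> * complex_of_real u))"

definition incomplete_J :: "complex \<Rightarrow> complex \<Rightarrow> real \<Rightarrow> complex" where
  "incomplete_J z \<nu> w =
     (LINT u:{0..w}|lborel. exp (- z * complex_of_real (cosh u)) * cosh (\<nu> * complex_of_real u))"

end

theory Submission
  imports Defs "HOL-Real_Asymp.Real_Asymp"
begin

text \<open>
  Let \<open>k(x) = 2 * K\<^bsub>im\<^esub>(x)\<close>, the Fourier transform at frequency \<open>m\<close> of \<open>exp (- x * cosh u)\<close> over the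
  whole real line. The theorem rests on a biorthogonality relation between the incomplete Bessel
  functions and the Macdonald functions, and on a bound for \<open>k\<close> that is strong enough to integrate the
  series term by term.

  \<^bold>\<open>Biorthogonality.\<close> Integration by parts gives
  \<open>J(x, in, \<pi>) / x = (1/n) * \<integral>\<^sub>0\<^sup>\<pi> sinh u * sin (n * u) * exp (- x * cosh u) du\<close>, so by Fubini the integral of
  \<open>J(x, in, \<pi>) * k(x) / x\<close> over \<open>x > 0\<close> is governed by the Laplace transform of \<open>k\<close> at \<open>cosh u\<close>, which is the
  Fourier transform of \<open>1 / (cosh u + cosh v)\<close> in \<open>v\<close>. This equals
  \<open>2 * \<pi> * sin (m * u) / (sinh u * sinh (\<pi> * m))\<close> (\<open>integral_inverse_cosh_plus_cosh_cis\<close>), and the orthogonality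
  of the sines on \<open>[0, \<pi>]\<close> finishes the computation (\<open>sine_kernel_macdonald_biorthogonal\<close>).
  The transform of \<open>1 / (1 + cosh v)\<close> is twice the product of two Gamma integrals, evaluated by the
  reflection formula, and \<open>2 * sinh u / (cosh u + cosh v)\<close> is the integral of its translates by
  \<open>w \<in> [-u, u]\<close>.

  \<^bold>\<open>The bound.\<close> Only the sum of \<open>|a\<^sub>m| * exp (- \<pi> * m / 2)\<close> is assumed to be finite, so no
  part of this exponential rate may be lost: for \<open>m \<ge> 1\<close> and \<open>x > 0\<close>,
  \<open>|k(x)| \<le> C * exp (- \<pi> * m / 2) * exp (4/5 * x)\<close> with \<open>C\<close> independent of \<open>m\<close> and \<open>x\<close>
  (\<open>macdonald_moment_uniform_bound\<close>); the quotient \<open>J(x, in, \<pi>) / x\<close> is \<open>O(exp (- x))\<close> and absorbs the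
  growth in \<open>x\<close>. By the modified Bessel equation the energy
  \<open>x\<^sup>2 * k'(x)\<^sup>2 + (m\<^sup>2 - x\<^sup>2) * k(x)\<^sup>2\<close> decreases in \<open>x\<close>. It is at most the squared modulus of
  \<open>x * k'(x) - i * m * k(x)\<close>, which after a translation of the integration variable is seen to tend to
  \<open>4 * |\<Gamma>(1 + im)|\<^sup>2 = 4 * \<pi> * m / sinh (\<pi> * m)\<close> as \<open>x\<close> tends to 0. This yields the bound when \<open>x\<close> is below a
  fixed multiple of \<open>m\<close>; otherwise \<open>|k(x)| = O(exp (- x))\<close> is enough.
\<close>

section \<open>Integration over the real line\<close>

lemma integral_real_line_FTC:
  fixes f F :: "real \<Rightarrow> 'a::euclidean_space"
  assumes deriv: "\<And>x. (F has_vector_derivative f x) (at x)"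
    and cont: "continuous_on UNIV f"
    and int: "integrable lborel f"
    and bot: "(F \<longlongrightarrow> A) at_bot" and top: "(F \<longlongrightarrow> B) at_top"
  shows "(\<integral>x. f x \<partial>lborel) = B - A"
proof -
  have "(LBINT x=-\<infinity>..\<infinity>. f x) = B - A"
  proof (rule interval_integral_FTC_integrable[where F = F])
    show "((F \<circ> real_of_ereal) \<longlongrightarrow> A) (at_right (-\<infinity>))"
      "((F \<circ> real_of_ereal) \<longlongrightarrow> B) (at_left \<infinity>)"
      using bot top by (simp_all add: ereal_tendsto_simps)
    show "set_integrable lborel (einterval (- \<infinity>) \<infinity>) f"
      using int by (simp add: set_integrable_def einterval_def)
  qed (use deriv cont in \<open>auto simp: continuous_on_eq_continuous_at\<close>)
  thus ?thesis
    by (simp add: interval_lebesgue_integral_def set_lebesgue_integral_def einterval_def)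
qed

lemma has_bochner_integral_real_line_FTC_nonneg:
  fixes f F :: "real \<Rightarrow> real"
  assumes deriv: "\<And>x. (F has_real_derivative f x) (at x)"
    and cont: "\<And>x. isCont f x"
    and nonneg: "\<And>x. f x \<ge> 0"
    and bot: "(F \<longlongrightarrow> A) at_bot" and top: "(F \<longlongrightarrow> B) at_top"
  shows "has_bochner_integral lborel f (B - A)"
proof -
  have *: "set_integrable lborel (einterval (-\<infinity>) \<infinity>) f" "(LBINT x=-\<infinity>..\<infinity>. f x) = B - A"
    by (rule interval_integral_FTC_nonneg[where F = F and A = A and B = B];
        use assms in \<open>auto simp: ereal_tendsto_simps\<close>)+
  thus ?thesis
    by (simp add: interval_lebesgue_integral_def set_lebesgue_integral_def set_integrable_def
        einterval_def has_bochner_integral_iff)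
qed

lemma integral_translate:
  fixes f :: "real \<Rightarrow> 'a::{banach, second_countable_topology}"
  shows "(\<integral>x. f (x + c) \<partial>lborel) = (\<integral>x. f x \<partial>lborel)"
  using lborel_integral_real_affine[of 1 f c] by (simp add: add.commute)

lemma integrable_translate:
  fixes f :: "real \<Rightarrow> 'a::{banach, second_countable_topology}"
  assumes "integrable lborel f"
  shows "integrable lborel (\<lambda>x. f (x + c))"
  using lborel_integrable_real_affine[OF assms, of 1 c] by (simp add: add.commute)

lemma integral_reflect:
  fixes f :: "real \<Rightarrow> 'a::{banach, second_countable_topology}"
  shows "(\<integral>x. f (- x) \<partial>lborel) = (\<integral>x. f x \<partial>lborel)"
  using lborel_integral_real_affine[of "-1" f 0] by simp

lemma abs_sinh_le_cosh: "\<bar>sinh u\<bar> \<le> cosh (u::real)"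
  by (simp add: sinh_def cosh_def abs_le_iff)

lemma borel_measurable_cosh [measurable]: "(cosh :: real \<Rightarrow> real) \<in> borel_measurable borel"
  by (intro borel_measurable_continuous_onI continuous_intros)

lemma borel_measurable_sinh [measurable]: "(sinh :: real \<Rightarrow> real) \<in> borel_measurable borel"
  by (intro borel_measurable_continuous_onI continuous_intros)

lemma borel_measurable_cis [measurable]: "cis \<in> borel_measurable borel"
  by (intro borel_measurable_continuous_onI continuous_intros)

lemma has_real_derivative_tanh_half:
  fixes u v :: real
  shows "((\<lambda>u. tanh ((v + u) / 2)) has_real_derivative 1 / (1 + cosh (v + u))) (at u within A)"
proof -
  have *: "1 + cosh (2 * w) = 2 * cosh w ^ 2" for w :: real
    using cosh_square_eq[of w] by (simp add: cosh_double)
  have "((\<lambda>u. tanh ((v + u) / 2)) has_real_derivative (1 - tanh ((v + u) / 2) ^ 2) * (1 / 2)) (at u within A)"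
    by (auto intro!: derivative_eq_intros)
  also have "(1 - tanh ((v + u) / 2) ^ 2) * (1 / 2) = 1 / (1 + cosh (2 * ((v + u) / 2)))"
    unfolding * tanh_def power_divide
    using cosh_square_eq[of "(v + u) / 2"] by (simp add: divide_simps add_nonneg_eq_0_iff)
  also have "2 * ((v + u) / 2) = v + u"
    by simp
  finally show ?thesis .
qed

lemma has_bochner_integral_inverse_1_plus_cosh:
  "has_bochner_integral lborel (\<lambda>u::real. 1 / (1 + cosh u)) 2"
proof -
  have "has_bochner_integral lborel (\<lambda>u::real. 1 / (1 + cosh u)) (1 - (-1))"
  proof (rule has_bochner_integral_real_line_FTC_nonneg[where F = "\<lambda>u. tanh (u / 2)"])
    show "((\<lambda>u::real. tanh (u / 2)) \<longlongrightarrow> -1) at_bot"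
      by (rule filterlim_compose[OF tanh_real_at_bot])
        (auto intro: filterlim_tendsto_pos_mult_at_bot[of "\<lambda>_. 1/2::real" "1/2", simplified] filterlim_ident)
    show "((\<lambda>u::real. tanh (u / 2)) \<longlongrightarrow> 1) at_top"
      by (rule filterlim_compose[OF tanh_real_at_top])
        (auto intro: filterlim_tendsto_pos_mult_at_top[of "\<lambda>_. 1/2::real" "1/2", simplified] filterlim_ident)
    show "isCont (\<lambda>u::real. 1 / (1 + cosh u)) u" for u
      using cosh_real_ge_1[of u] by (auto intro!: continuous_intros)
    show "1 / (1 + cosh u) \<ge> 0" for u :: real
      by simp
    show "((\<lambda>u. tanh (u / 2)) has_real_derivative 1 / (1 + cosh u)) (at u)" for u :: real
      using has_real_derivative_tanh_half[of 0] by simp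
  qed
  thus ?thesis by simp
qed

lemma power_le_fact_mult_exp:
  assumes "(y::real) \<ge> 0"
  shows "y ^ n \<le> fact n * exp y"
proof -
  have "(\<Sum>k\<in>{n}. y ^ k /\<^sub>R fact k) \<le> (\<Sum>k. y ^ k /\<^sub>R fact k)"
    using assms by (intro sum_le_suminf summable_exp_generic) auto
  thus ?thesis
    by (simp add: exp_def field_simps)
qed

lemma integrable_cosh_power_exp:
  assumes x: "x > (0::real)"
  shows "integrable lborel (\<lambda>u. cosh u ^ j * exp (- x * cosh u))"
proof -
  define C where "C = 2 * fact (j + 1) / x ^ (j + 1)"
  have C: "cosh u ^ j * exp (- x * cosh u) \<le> C * (1 / (1 + cosh u))" for u :: real
  proof -
    have "cosh u ^ j * (1 + cosh u) \<le> cosh u ^ j * (2 * cosh u)"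
      using cosh_real_ge_1[of u] by (intro mult_left_mono) auto
    also have "\<dots> = 2 / x ^ (j + 1) * (x * cosh u) ^ (j + 1)"
      using x by (simp add: field_simps)
    also have "\<dots> \<le> 2 / x ^ (j + 1) * (fact (j + 1) * exp (x * cosh u))"
      using x by (intro mult_left_mono power_le_fact_mult_exp) auto
    also have "\<dots> = C * exp (x * cosh u)"
      by (simp add: C_def)
    finally show ?thesis
      using cosh_real_ge_1[of u] by (simp add: exp_minus field_simps)
  qed
  have "integrable lborel (\<lambda>u::real. C * (1 / (1 + cosh u)))"
    using has_bochner_integral_inverse_1_plus_cosh
    by (intro integrable_mult_right) (auto simp: has_bochner_integral_iff)
  moreover have "(\<lambda>u. cosh u ^ j * exp (- x * cosh u)) \<in> borel_measurable lborel"
    by measurable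
  moreover have "norm (cosh u ^ j * exp (- x * cosh u)) \<le> norm (C * (1 / (1 + cosh u)))" for u
  proof -
    have "norm (cosh u ^ j * exp (- x * cosh u)) = cosh u ^ j * exp (- x * cosh u)"
      by simp
    also note C
    also note abs_ge_self
    finally show ?thesis by simp
  qed
  ultimately show ?thesis
    by (rule Bochner_Integration.integrable_bound[OF _ _ AE_I2])
qed

section \<open>Fourier transforms against the Macdonald kernel\<close>

text \<open>
  The Fourier transform at frequency \<open>\<tau>\<close> of \<open>u \<mapsto> g u * exp (- x * cosh u)\<close> over the whole
  real line. For \<open>g = (\<lambda>_. 1)\<close> this is twice the Macdonald function of order \<open>\<i> * \<tau>\<close> at \<open>x\<close>.
\<close>

definition macdonald_transform :: "(real \<Rightarrow> real) \<Rightarrow> real \<Rightarrow> real \<Rightarrow> complex" where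
  "macdonald_transform g \<tau> x =
     (\<integral>u. complex_of_real (g u * exp (- x * cosh u)) * cis (\<tau> * u) \<partial>lborel)"

lemma integrable_mult_exp_cosh:
  fixes g :: "real \<Rightarrow> real"
  assumes x: "x > 0" and [measurable]: "g \<in> borel_measurable borel"
    and bound: "\<And>u. \<bar>g u\<bar> \<le> C * cosh u ^ j"
  shows "integrable lborel (\<lambda>u. g u * exp (- x * cosh u))"
proof (rule Bochner_Integration.integrable_bound)
  show "integrable lborel (\<lambda>u. C * (cosh u ^ j * exp (- x * cosh u)))"
    by (intro integrable_mult_right integrable_cosh_power_exp x)
  show "AE u in lborel. norm (g u * exp (- x * cosh u)) \<le> norm (C * (cosh u ^ j * exp (- x * cosh u)))"
  proof (intro AE_I2)
    fix u
    have "norm (g u * exp (- x * cosh u)) = \<bar>g u\<bar> * exp (- x * cosh u)"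
      by (simp add: abs_mult)
    also have "\<dots> \<le> (C * cosh u ^ j) * exp (- x * cosh u)"
      by (intro mult_right_mono bound) auto
    also have "\<dots> \<le> norm (C * (cosh u ^ j * exp (- x * cosh u)))"
      by (simp add: mult.assoc)
    finally show "norm (g u * exp (- x * cosh u)) \<le> norm (C * (cosh u ^ j * exp (- x * cosh u)))" .
  qed
qed measurable

lemma integrable_macdonald_transform:
  fixes g :: "real \<Rightarrow> real"
  assumes x: "x > 0" and [measurable]: "g \<in> borel_measurable borel"
    and bound: "\<And>u. \<bar>g u\<bar> \<le> C * cosh u ^ j"
  shows "integrable lborel (\<lambda>u. complex_of_real (g u * exp (- x * cosh u)) * cis (\<tau> * u))"
proof (rule Bochner_Integration.integrable_bound)
  show "integrable lborel (\<lambda>u. g u * exp (- x * cosh u))"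
    by (rule integrable_mult_exp_cosh[OF assms])
  show "AE u in lborel. norm (complex_of_real (g u * exp (- x * cosh u)) * cis (\<tau> * u))
          \<le> norm (g u * exp (- x * cosh u))"
    by (intro AE_I2) (simp add: norm_mult)
qed measurable

lemma macdonald_transform_add:
  assumes "x > 0" "g \<in> borel_measurable borel" "h \<in> borel_measurable borel"
    and "\<And>u. \<bar>g u\<bar> \<le> C * cosh u ^ j" "\<And>u. \<bar>h u\<bar> \<le> D * cosh u ^ k"
  shows "macdonald_transform (\<lambda>u. g u + h u) \<tau> x
           = macdonald_transform g \<tau> x + macdonald_transform h \<tau> x"
proof -
  have "integrable lborel (\<lambda>u. complex_of_real (g u * exp (- x * cosh u)) * cis (\<tau> * u))"
    "integrable lborel (\<lambda>u. complex_of_real (h u * exp (- x * cosh u)) * cis (\<tau> * u))"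
    by (rule integrable_macdonald_transform; fact assms)+
  from Bochner_Integration.integral_add[OF this] show ?thesis
    unfolding macdonald_transform_def distrib_right of_real_add .
qed

text \<open>Since the kernel is even, the transform of an even function is real.\<close>

lemma macdonald_transform_even_real:
  assumes "\<And>u. g (- u) = g u"
  shows "macdonald_transform g \<tau> x = of_real (Re (macdonald_transform g \<tau> x))"
proof -
  have "cnj (macdonald_transform g \<tau> x)
          = (\<integral>u. complex_of_real (g u * exp (- x * cosh u)) * cis (\<tau> * - u) \<partial>lborel)"
    by (simp add: macdonald_transform_def cis_cnj flip: Bochner_Integration.integral_cnj)
  also have "\<dots> = (\<integral>u. complex_of_real (g (- u) * exp (- x * cosh (- u))) * cis (\<tau> * - u) \<partial>lborel)"
    by (simp add: assms)
  also have "\<dots> = macdonald_transform g \<tau> x"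
    unfolding macdonald_transform_def by (rule integral_reflect)
  finally show ?thesis
    by (metis Reals_cnj_iff of_real_Re)
qed

lemma Re_macdonald_transform:
  assumes x: "x > 0" and [measurable]: "g \<in> borel_measurable borel"
    and bound: "\<And>u. \<bar>g u\<bar> \<le> C * cosh u ^ j"
  shows "Re (macdonald_transform g \<tau> x) = (\<integral>u. (g u * cos (\<tau> * u)) * exp (- x * cosh u) \<partial>lborel)"
proof -
  have "Re (macdonald_transform g \<tau> x)
          = (\<integral>u. Re (complex_of_real (g u * exp (- x * cosh u)) * cis (\<tau> * u)) \<partial>lborel)"
    unfolding macdonald_transform_def
    by (rule integral_Re[OF integrable_macdonald_transform[OF assms], symmetric])
  also have "\<dots> = (\<integral>u. (g u * cos (\<tau> * u)) * exp (- x * cosh u) \<partial>lborel)"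
    by (intro Bochner_Integration.integral_cong) auto
  finally show ?thesis .
qed

text \<open>Integration by parts: the integral of the derivative of
  \<open>g u * exp (- x * cosh u) * cis (\<tau> * u)\<close> over the real line vanishes.\<close>

lemma macdonald_transform_by_parts:
  fixes g g' :: "real \<Rightarrow> real"
  assumes x: "x > 0" and deriv: "\<And>u. (g has_real_derivative g' u) (at u)"
    and cont: "continuous_on UNIV g'"
    and g: "\<And>u. \<bar>g u\<bar> \<le> C * cosh u ^ j" and g': "\<And>u. \<bar>g' u\<bar> \<le> D * cosh u ^ k"
  shows "\<i> * \<tau> * macdonald_transform g \<tau> x
           = of_real x * macdonald_transform (\<lambda>u. sinh u * g u) \<tau> x - macdonald_transform g' \<tau> x"
proof -
  have cont_g: "continuous_on UNIV g"
    by (rule DERIV_continuous_on) (use deriv in \<open>auto intro: has_field_derivative_at_within\<close>)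
  have g_meas [measurable]: "g \<in> borel_measurable borel"
    using cont_g by (rule borel_measurable_continuous_onI)
  have g'_meas [measurable]: "g' \<in> borel_measurable borel"
    using cont by (rule borel_measurable_continuous_onI)
  define G where "G = (\<lambda>u. complex_of_real (g u * exp (- x * cosh u)) * cis (\<tau> * u))"
  define H1 where "H1 = (\<lambda>u. complex_of_real (g' u * exp (- x * cosh u)) * cis (\<tau> * u))"
  define H2 where "H2 = (\<lambda>u. complex_of_real ((sinh u * g u) * exp (- x * cosh u)) * cis (\<tau> * u))"
  have sg: "\<bar>sinh u * g u\<bar> \<le> C * cosh u ^ (Suc j)" for u
  proof -
    have "\<bar>sinh u * g u\<bar> \<le> cosh u * (C * cosh u ^ j)"
      unfolding abs_mult by (intro mult_mono g abs_sinh_le_cosh) auto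
    thus ?thesis by (simp add: mult_ac)
  qed
  have int: "integrable lborel G" "integrable lborel H1" "integrable lborel H2"
    unfolding G_def H1_def H2_def
    by (rule integrable_macdonald_transform[OF x _ g] integrable_macdonald_transform[OF x _ g']
        integrable_macdonald_transform[OF x _ sg]; measurable)+
  have G_le: "norm (G u) \<le> C * (cosh u ^ j * exp (- x * cosh u))" for u
    using mult_right_mono[OF g[of u], of "exp (- x * cosh u)"]
    by (simp add: G_def norm_mult abs_mult mult.assoc)
  have "((\<lambda>u::real. cosh u ^ j * exp (- x * cosh u)) \<longlongrightarrow> 0) F" if "filterlim cosh at_top F" for F
  proof -
    have "((\<lambda>t::real. t ^ j * exp (- x * t)) \<longlongrightarrow> 0) at_top"
      using x by real_asymp
    from filterlim_compose[OF this that] show ?thesis by simp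
  qed
  hence lim: "(G \<longlongrightarrow> 0) F" if "filterlim cosh at_top F" for F
    using that by (intro Lim_null_comparison[OF always_eventually[OF allI[OF G_le]]])
      (auto intro!: tendsto_mult_right_zero)
  have "(\<integral>u. H1 u - of_real x * H2 u + \<i> * \<tau> * G u \<partial>lborel) = 0 - 0"
  proof (rule integral_real_line_FTC)
    show "(G has_vector_derivative H1 u - of_real x * H2 u + \<i> * \<tau> * G u) (at u)" for u
    proof -
      have 1: "((\<lambda>u. g u * exp (- x * cosh u)) has_real_derivative
             (g' u * exp (- x * cosh u) + g u * (exp (- x * cosh u) * (- x * sinh u)))) (at u)"
        by (auto intro!: derivative_eq_intros deriv)
      have 2: "((\<lambda>u. cis (\<tau> * u)) has_vector_derivative (\<tau> *\<^sub>R (\<i> * cis (\<tau> * u)))) (at u)"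
        by (auto simp: has_vector_derivative_complex_iff intro!: derivative_eq_intros)
      have "(G has_vector_derivative
            (complex_of_real (g u * exp (- x * cosh u)) * (\<tau> *\<^sub>R (\<i> * cis (\<tau> * u))) +
             of_real (g' u * exp (- x * cosh u) + g u * (exp (- x * cosh u) * (- x * sinh u))) * cis (\<tau> * u))) (at u)"
        unfolding G_def
        by (intro has_vector_derivative_mult 2 has_vector_derivative_of_real)
          (use 1 in \<open>simp add: has_real_derivative_iff_has_vector_derivative\<close>)
      thus ?thesis
        by (simp add: G_def H1_def H2_def algebra_simps scaleR_conv_of_real)
    qed
    show "continuous_on UNIV (\<lambda>u. H1 u - of_real x * H2 u + \<i> * \<tau> * G u)"
      unfolding G_def H1_def H2_def by (intro continuous_intros cont cont_g)
    show "integrable lborel (\<lambda>u. H1 u - of_real x * H2 u + \<i> * \<tau> * G u)"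
      using int by auto
    show "(G \<longlongrightarrow> 0) at_bot" "(G \<longlongrightarrow> 0) at_top"
      by (rule lim, real_asymp)+
  qed
  hence "(\<integral>u. H1 u \<partial>lborel) - of_real x * (\<integral>u. H2 u \<partial>lborel) + \<i> * \<tau> * (\<integral>u. G u \<partial>lborel) = 0"
    using int by simp
  thus ?thesis
    unfolding macdonald_transform_def G_def H1_def H2_def by (simp add: algebra_simps)
qed

text \<open>Differentiation under the integral sign.\<close>

lemma has_real_derivative_integral_exp_cosh:
  fixes g :: "real \<Rightarrow> real"
  assumes x: "x > 0" and [measurable]: "g \<in> borel_measurable borel"
    and bound: "\<And>u. \<bar>g u\<bar> \<le> C * cosh u ^ j"
  shows "((\<lambda>x. \<integral>u. g u * exp (- x * cosh u) \<partial>lborel) has_real_derivative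
           - (\<integral>u. (cosh u * g u) * exp (- x * cosh u) \<partial>lborel)) (at x)"
proof -
  have bound': "\<bar>cosh u * g u\<bar> \<le> C * cosh u ^ Suc j" for u
    using mult_left_mono[OF bound[of u], of "cosh u"] by (simp add: abs_mult mult_ac)
  note int = integrable_mult_exp_cosh[OF _ assms(2) bound]
  note int' = integrable_mult_exp_cosh[OF _ _ bound', simplified]
  define Q where "Q = (\<lambda>h u. g u * ((exp (- (x + h) * cosh u) - exp (- x * cosh u)) / h))"
  have Q_bound: "\<bar>Q h u\<bar> \<le> \<bar>cosh u * g u * exp (- (x / 2) * cosh u)\<bar>"
    if h: "h \<in> {- x/2<..<x/2} - {0}" for h u
  proof -
    have A: "exp a - exp b \<le> \<bar>a - b\<bar> * exp m" if "a \<le> m" "b \<le> m" for a b m :: real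
    proof -
      have "exp a - exp b = exp a * (1 - exp (b - a))"
        by (simp add: exp_diff field_simps)
      also have "\<dots> \<le> exp a * \<bar>a - b\<bar>"
        using exp_ge_add_one_self[of "b - a"] by (intro mult_left_mono) (linarith, simp)
      also have "\<dots> \<le> exp m * \<bar>a - b\<bar>"
        using that by (intro mult_right_mono) auto
      finally show ?thesis by (simp add: mult_ac)
    qed
    have A': "\<bar>exp a - exp b\<bar> \<le> \<bar>a - b\<bar> * exp m" if "a \<le> m" "b \<le> m" for a b m :: real
      using A[OF that] A[OF that(2,1)] by (simp only: abs_le_iff abs_minus_commute[of b a] minus_diff_eq)
    have 1: "- (x + h) * cosh u \<le> - (x / 2) * cosh u" "- x * cosh u \<le> - (x / 2) * cosh u"
      using h x by (intro mult_right_mono; simp)+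
    have "\<bar>exp (- (x + h) * cosh u) - exp (- x * cosh u)\<bar>
          \<le> \<bar>- (x + h) * cosh u - - x * cosh u\<bar> * exp (- (x / 2) * cosh u)"
      by (rule A'[OF 1])
    also have "- (x + h) * cosh u - - x * cosh u = - h * cosh u"
      by (simp add: algebra_simps)
    also have "\<bar>- h * cosh u\<bar> * exp (- (x / 2) * cosh u) = \<bar>h\<bar> * (cosh u * exp (- (x / 2) * cosh u))"
      by (simp add: abs_mult)
    finally have "\<bar>exp (- (x + h) * cosh u) - exp (- x * cosh u)\<bar> / \<bar>h\<bar> \<le> cosh u * exp (- (x / 2) * cosh u)"
      using h by (simp add: field_simps)
    hence "\<bar>g u\<bar> * (\<bar>exp (- (x + h) * cosh u) - exp (- x * cosh u)\<bar> / \<bar>h\<bar>)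
            \<le> \<bar>g u\<bar> * (cosh u * exp (- (x / 2) * cosh u))"
      by (intro mult_left_mono) auto
    thus ?thesis
      by (simp add: Q_def abs_mult abs_divide mult_ac)
  qed
  have "((\<lambda>h. \<integral>u. Q h u \<partial>lborel) \<longlongrightarrow> (\<integral>u. - ((cosh u * g u) * exp (- x * cosh u)) \<partial>lborel))
          (at 0 within {- x/2<..<x/2})"
    unfolding tendsto_at_iff_sequentially o_def
  proof safe
    fix X :: "nat \<Rightarrow> real"
    assume X: "\<forall>i. X i \<in> {- x/2<..<x/2} - {0}" "X \<longlonglongrightarrow> 0"
    show "(\<lambda>i. \<integral>u. Q (X i) u \<partial>lborel) \<longlonglongrightarrow> (\<integral>u. - ((cosh u * g u) * exp (- x * cosh u)) \<partial>lborel)"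
    proof (rule integral_dominated_convergence)
      show "integrable lborel (\<lambda>u. \<bar>cosh u * g u * exp (- (x / 2) * cosh u)\<bar>)"
        using int'[of "x/2"] x by (intro integrable_abs) simp
      show "AE u in lborel. norm (Q (X i) u) \<le> \<bar>cosh u * g u * exp (- (x / 2) * cosh u)\<bar>" for i
        using Q_bound X(1) by (intro AE_I2) auto
      show "AE u in lborel. (\<lambda>i. Q (X i) u) \<longlonglongrightarrow> - ((cosh u * g u) * exp (- x * cosh u))"
      proof (intro AE_I2)
        fix u
        have "((\<lambda>x. g u * exp (- x * cosh u)) has_real_derivative - ((cosh u * g u) * exp (- x * cosh u))) (at x)"
          by (auto intro!: derivative_eq_intros)
        hence "((\<lambda>h. Q h u) \<longlongrightarrow> - ((cosh u * g u) * exp (- x * cosh u))) (at 0)"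
          by (simp add: DERIV_def Q_def right_diff_distrib left_diff_distrib distrib_right)
        thus "(\<lambda>i. Q (X i) u) \<longlonglongrightarrow> - ((cosh u * g u) * exp (- x * cosh u))"
          using X by (auto simp: tendsto_at_iff_sequentially o_def)
      qed
    qed (simp_all add: Q_def)
  qed
  hence lim: "((\<lambda>h. \<integral>u. Q h u \<partial>lborel) \<longlongrightarrow> - (\<integral>u. (cosh u * g u) * exp (- x * cosh u) \<partial>lborel))
          (at 0 within {- x/2<..<x/2})"
    by simp
  have "((\<lambda>h. ((\<integral>u. g u * exp (- (x + h) * cosh u) \<partial>lborel) - (\<integral>u. g u * exp (- x * cosh u) \<partial>lborel)) / h)
          \<longlongrightarrow> - (\<integral>u. (cosh u * g u) * exp (- x * cosh u) \<partial>lborel)) (at 0 within {- x/2<..<x/2})"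
  proof (rule Lim_transform_eventually[OF lim])
    have "(\<integral>u. Q h u \<partial>lborel) = ((\<integral>u. g u * exp (- (x + h) * cosh u) \<partial>lborel) - (\<integral>u. g u * exp (- x * cosh u) \<partial>lborel)) / h"
      if "h \<in> {- x/2<..<x/2}" for h
    proof -
      have "integrable lborel (\<lambda>u. g u * exp (- (x + h) * cosh u))" "integrable lborel (\<lambda>u. g u * exp (- x * cosh u))"
        using that x by (intro int; simp)+
      thus ?thesis
        unfolding Q_def
        by (subst Bochner_Integration.integral_diff[symmetric])
          (simp_all flip: integral_divide_zero add: right_diff_distrib)
    qed
    thus "\<forall>\<^sub>F h in at 0 within {- x / 2<..<x / 2}. (\<integral>u. Q h u \<partial>lborel)
          = ((\<integral>u. g u * exp (- (x + h) * cosh u) \<partial>lborel) - (\<integral>u. g u * exp (- x * cosh u) \<partial>lborel)) / h"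
      by (auto simp: eventually_at_filter)
  qed
  moreover have "at 0 within {- x / 2<..<x / 2} = at 0"
    using x by (intro at_within_open) auto
  ultimately show ?thesis
    unfolding DERIV_def by (simp only:)
qed

section \<open>The modified Bessel equation and its energy\<close>

text \<open>
  The moments of the Macdonald kernel with respect to powers of \<open>cosh\<close>; these transforms are real.
  On the positive axis \<open>macdonald_moment 0 \<tau>\<close> is twice the Macdonald function of order \<open>\<i> * \<tau>\<close>, and
  \<open>macdonald_moment j \<tau>\<close> is \<open>(- 1) ^ j\<close> times the \<open>j\<close>-th derivative of \<open>macdonald_moment 0 \<tau>\<close>.
\<close>

definition macdonald_moment :: "nat \<Rightarrow> real \<Rightarrow> real \<Rightarrow> real" where
  "macdonald_moment j \<tau> x = Re (macdonald_transform (\<lambda>u. cosh u ^ j) \<tau> x)"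

lemma macdonald_transform_cosh_power:
  "macdonald_transform (\<lambda>u. cosh u ^ j) \<tau> x = of_real (macdonald_moment j \<tau> x)"
  unfolding macdonald_moment_def by (rule macdonald_transform_even_real) simp

lemma macdonald_moment_eq_integral:
  assumes "x > 0"
  shows "macdonald_moment j \<tau> x = (\<integral>u. (cosh u ^ j * cos (\<tau> * u)) * exp (- x * cosh u) \<partial>lborel)"
  unfolding macdonald_moment_def
  by (rule Re_macdonald_transform[OF assms, of _ 1 j]) auto

lemma abs_cosh_power_mult_cos_le: "\<bar>cosh u ^ j * cos (\<tau> * u)\<bar> \<le> 1 * cosh (u::real) ^ j"
  by (simp add: abs_mult mult_left_le)

lemma has_real_derivative_macdonald_moment:
  assumes x: "x > 0"
  shows "(macdonald_moment j \<tau> has_real_derivative - macdonald_moment (Suc j) \<tau> x) (at x)"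
proof -
  have "((\<lambda>x. \<integral>u. (cosh u ^ j * cos (\<tau> * u)) * exp (- x * cosh u) \<partial>lborel) has_real_derivative
          - (\<integral>u. (cosh u * (cosh u ^ j * cos (\<tau> * u))) * exp (- x * cosh u) \<partial>lborel)) (at x)"
    by (rule has_real_derivative_integral_exp_cosh[OF x _ abs_cosh_power_mult_cos_le]) measurable
  hence "(macdonald_moment j \<tau> has_real_derivative
          - (\<integral>u. (cosh u * (cosh u ^ j * cos (\<tau> * u))) * exp (- x * cosh u) \<partial>lborel)) (at x)"
    by (rule has_field_derivative_transform_within_open[where S = "{0<..}"])
      (use x in \<open>auto simp: macdonald_moment_eq_integral\<close>)
  thus ?thesis
    using x by (simp add: macdonald_moment_eq_integral mult.assoc)
qed

lemma macdonald_transform_sinh: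
  assumes x: "x > 0"
  shows "of_real x * macdonald_transform sinh \<tau> x = \<i> * \<tau> * of_real (macdonald_moment 0 \<tau> x)"
proof -
  have "\<i> * \<tau> * macdonald_transform (\<lambda>_. 1) \<tau> x
          = of_real x * macdonald_transform (\<lambda>u. sinh u * 1) \<tau> x - macdonald_transform (\<lambda>_. 0) \<tau> x"
    by (rule macdonald_transform_by_parts[OF x, where C = 1 and D = 0 and j = 0 and k = 0]) auto
  moreover have "macdonald_transform (\<lambda>_. 0) \<tau> x = 0"
    by (simp add: macdonald_transform_def)
  moreover have "macdonald_transform (\<lambda>_. 1) \<tau> x = of_real (macdonald_moment 0 \<tau> x)"
    using macdonald_transform_cosh_power[of 0] by simp
  ultimately show ?thesis
    by simp
qed

text \<open>The modified Bessel equation, from \<open>cosh\<^sup>2 = sinh\<^sup>2 + 1\<close> and two integrations by parts.\<close>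

lemma macdonald_moment_bessel_equation:
  assumes x: "x > 0"
  shows "x\<^sup>2 * macdonald_moment 2 \<tau> x - x * macdonald_moment 1 \<tau> x
           - (x\<^sup>2 - \<tau>\<^sup>2) * macdonald_moment 0 \<tau> x = 0"
proof -
  let ?M = "\<lambda>j. complex_of_real (macdonald_moment j \<tau> x)"
  let ?T = "\<lambda>g. macdonald_transform g \<tau> x"
  have parts: "\<i> * \<tau> * ?T sinh = of_real x * ?T (\<lambda>u. sinh u * sinh u) - ?T cosh"
    by (rule macdonald_transform_by_parts[OF x, where C = 1 and D = 1 and j = 1 and k = 1])
      (auto intro!: derivative_eq_intros continuous_intros abs_sinh_le_cosh)
  have "?T (\<lambda>u. sinh u * sinh u + 1) = ?T (\<lambda>u. sinh u * sinh u) + ?T (\<lambda>_. 1)"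
  proof (rule macdonald_transform_add[OF x, where C = 1 and D = 1 and j = 2 and k = 0])
    show "\<bar>sinh u * sinh u\<bar> \<le> 1 * cosh u ^ 2" for u :: real
      unfolding cosh_square_eq by (simp add: power2_eq_square)
  qed auto
  also have "?T (\<lambda>_. 1) = ?M 0"
    using macdonald_transform_cosh_power[of 0] by simp
  also have "(\<lambda>u::real. sinh u * sinh u + 1) = (\<lambda>u. cosh u ^ 2)"
    by (rule ext) (simp add: cosh_square_eq flip: power2_eq_square)
  finally have M2: "?M 2 = ?T (\<lambda>u. sinh u * sinh u) + ?M 0"
    by (simp add: macdonald_transform_cosh_power)
  have M1: "?T cosh = ?M 1"
    using macdonald_transform_cosh_power[of 1] by simp
  have "\<i> * \<tau> * (of_real x * ?T sinh) = of_real x * (\<i> * \<tau> * ?T sinh)"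
    by (simp add: mult_ac)
  also have "\<dots> = of_real x * (of_real x * (?M 2 - ?M 0) - ?M 1)"
    unfolding parts M1 M2 by simp
  finally have "\<i> * \<tau> * (\<i> * \<tau> * ?M 0) = of_real x * (of_real x * (?M 2 - ?M 0) - ?M 1)"
    unfolding macdonald_transform_sinh[OF x] .
  hence "complex_of_real (- (\<tau>\<^sup>2 * macdonald_moment 0 \<tau> x))
     = of_real (x * (x * (macdonald_moment 2 \<tau> x - macdonald_moment 0 \<tau> x) - macdonald_moment 1 \<tau> x))"
    by (simp add: power2_eq_square mult_ac)
  hence "- (\<tau>\<^sup>2 * macdonald_moment 0 \<tau> x)
     = x * (x * (macdonald_moment 2 \<tau> x - macdonald_moment 0 \<tau> x) - macdonald_moment 1 \<tau> x)"
    unfolding of_real_eq_iff .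
  thus ?thesis
    by (simp add: algebra_simps power2_eq_square)
qed

text \<open>
  The two terms of the energy are, up to a part \<open>x\<^sup>2 * macdonald_moment 0 \<tau> x ^ 2\<close>, the squared real and
  imaginary part of a single transform, whose behaviour at \<open>x = 0\<close> can be read off.
\<close>

lemma macdonald_transform_exp:
  assumes x: "x > 0"
  shows "of_real x * macdonald_transform exp \<tau> x
           = of_real (x * macdonald_moment 1 \<tau> x) + \<i> * of_real (\<tau> * macdonald_moment 0 \<tau> x)"
proof -
  have "macdonald_transform (\<lambda>u. cosh u + sinh u) \<tau> x
          = macdonald_transform cosh \<tau> x + macdonald_transform sinh \<tau> x"
    by (rule macdonald_transform_add[OF x, where C = 1 and D = 1 and j = 1 and k = 1])
      (auto intro!: abs_sinh_le_cosh)
  moreover have "macdonald_transform cosh \<tau> x = of_real (macdonald_moment 1 \<tau> x)"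
    using macdonald_transform_cosh_power[of 1] by simp
  moreover have "(\<lambda>u::real. cosh u + sinh u) = exp"
    by (simp add: cosh_plus_sinh fun_eq_iff)
  ultimately show ?thesis
    using macdonald_transform_sinh[OF x, of \<tau>] by (simp add: algebra_simps)
qed

text \<open>
  With \<open>k = macdonald_moment 0 \<tau>\<close> and \<open>x > 0\<close>, the energy \<open>x\<^sup>2 * k' x ^ 2 + (\<tau>\<^sup>2 - x\<^sup>2) * k x ^ 2\<close> has derivative
  \<open>- 2 * x * k x ^ 2\<close> by the Bessel equation, hence it decreases.
\<close>

lemma macdonald_moment_energy_le:
  assumes y: "0 < y" "y \<le> x"
  shows "(\<tau>\<^sup>2 - x\<^sup>2) * macdonald_moment 0 \<tau> x ^ 2 \<le> norm (of_real y * macdonald_transform exp \<tau> y) ^ 2"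
proof -
  define E where "E = (\<lambda>x. x\<^sup>2 * macdonald_moment 1 \<tau> x ^ 2 + (\<tau>\<^sup>2 - x\<^sup>2) * macdonald_moment 0 \<tau> x ^ 2)"
  have "E x \<le> E y"
  proof (rule DERIV_nonpos_imp_nonincreasing[OF y(2)])
    fix z assume z: "y \<le> z" "z \<le> x"
    hence z0: "z > 0" using y by simp
    have D0: "(macdonald_moment 0 \<tau> has_real_derivative - macdonald_moment 1 \<tau> z) (at z)"
      using has_real_derivative_macdonald_moment[OF z0, of 0 \<tau>] by simp
    have D1: "(macdonald_moment 1 \<tau> has_real_derivative - macdonald_moment 2 \<tau> z) (at z)"
      using has_real_derivative_macdonald_moment[OF z0, of 1 \<tau>] by (simp add: numeral_2_eq_2)
    let ?m = "\<lambda>j. macdonald_moment j \<tau> z"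
    have "(E has_real_derivative (2 * z * ?m 1 ^ 2 + z\<^sup>2 * (2 * ?m 1 * (- ?m 2))
            + (- (2 * z) * ?m 0 ^ 2 + (\<tau>\<^sup>2 - z\<^sup>2) * (2 * ?m 0 * (- ?m 1))))) (at z)"
      unfolding E_def by (rule derivative_eq_intros D0 D1 refl | simp)+
    also have "2 * z * ?m 1 ^ 2 + z\<^sup>2 * (2 * ?m 1 * (- ?m 2))
            + (- (2 * z) * ?m 0 ^ 2 + (\<tau>\<^sup>2 - z\<^sup>2) * (2 * ?m 0 * (- ?m 1)))
          = - 2 * z * ?m 0 ^ 2 - 2 * ?m 1 * (z\<^sup>2 * ?m 2 - z * ?m 1 - (z\<^sup>2 - \<tau>\<^sup>2) * ?m 0)"
      by (simp add: algebra_simps power2_eq_square)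
    also have "\<dots> = - 2 * z * ?m 0 ^ 2"
      using macdonald_moment_bessel_equation[OF z0, of \<tau>] by simp
    finally show "\<exists>d. (E has_real_derivative d) (at z) \<and> d \<le> 0"
      using z0 by (intro exI[of _ "- 2 * z * ?m 0 ^ 2"]) auto
  qed
  also have "E y \<le> norm (of_real y * macdonald_transform exp \<tau> y) ^ 2"
    unfolding macdonald_transform_exp[OF y(1)] cmod_power2
    by (simp add: E_def algebra_simps power_mult_distrib)
  finally show ?thesis
    unfolding E_def using zero_le_power2[of "x * macdonald_moment 1 \<tau> x"]
    unfolding power_mult_distrib by linarith
qed

section \<open>The Gamma function on the line of real part one\<close>

lemma has_bochner_integral_exp_minus_exp:
  "has_bochner_integral lborel (\<lambda>t::real. exp t * exp (- exp t)) 1"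
proof -
  have "has_bochner_integral lborel (\<lambda>t::real. exp t * exp (- exp t)) (0 - (-1))"
  proof (rule has_bochner_integral_real_line_FTC_nonneg[where F = "\<lambda>t. - exp (- exp t)"])
    show "((\<lambda>t::real. - exp (- exp t)) \<longlongrightarrow> -1) at_bot" "((\<lambda>t::real. - exp (- exp t)) \<longlongrightarrow> 0) at_top"
      by real_asymp+
  qed (auto intro!: derivative_eq_intros)
  thus ?thesis by simp
qed

lemma integrable_exp_minus_exp_cis:
  "integrable lborel (\<lambda>t. complex_of_real (exp t * exp (- exp t)) * cis (\<tau> * t))"
proof (rule Bochner_Integration.integrable_bound)
  show "integrable lborel (\<lambda>t::real. exp t * exp (- exp t))"
    using has_bochner_integral_exp_minus_exp by (auto simp: has_bochner_integral_iff)
  show "AE t in lborel. norm (complex_of_real (exp t * exp (- exp t)) * cis (\<tau> * t))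
          \<le> norm (exp t * exp (- exp t))"
    by (simp add: norm_mult)
qed measurable

lemma integral_exp_minus_exp_cis:
  "(\<integral>t. complex_of_real (exp t * exp (- exp t)) * cis (\<tau> * t) \<partial>lborel) = Gamma (1 + \<i> * \<tau>)"
proof -
  define f where "f = (\<lambda>t. complex_of_real t powr (1 + \<i> * \<tau> - 1) / of_real (exp t))"
  have f_exp: "exp x *\<^sub>R f (exp x) = complex_of_real (exp x * exp (- exp x)) * cis (\<tau> * x)" for x
    by (simp add: f_def powr_def Ln_of_real cis_conv_exp scaleR_conv_of_real exp_minus field_simps)
  have "(\<lambda>t. indicator {0<..} t *\<^sub>R f t) \<in> borel_measurable borel"
    unfolding f_def
    by (intro borel_measurable_continuous_on_indicator continuous_intros)
      (auto simp: complex_nonpos_Reals_iff)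
  hence meas: "(\<lambda>t. indicator {0<..} t *\<^sub>R f t) \<in> borel_measurable lborel"
    by simp
  have "(LBINT t=0..\<infinity>. f t) = (LBINT x=-\<infinity>..\<infinity>. exp x *\<^sub>R f (exp x))"
  proof (rule interval_integral_substitution_integrable)
    show "((ereal \<circ> exp \<circ> real_of_ereal) \<longlongrightarrow> 0) (at_right (- \<infinity>))"
      unfolding ereal_tendsto_simps by (simp add: o_def zero_ereal_def exp_at_bot)
    show "((ereal \<circ> exp \<circ> real_of_ereal) \<longlongrightarrow> \<infinity>) (at_left \<infinity>)"
      unfolding ereal_tendsto_simps by (simp add: o_def exp_at_top)
    show "isCont f (exp x)" for x
      unfolding f_def by (intro continuous_intros) (auto simp: complex_nonpos_Reals_iff)
    show "set_integrable lborel (einterval (- \<infinity>) \<infinity>) (\<lambda>x. exp x *\<^sub>R f (exp x))"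
      unfolding f_exp using integrable_exp_minus_exp_cis
      by (simp add: set_integrable_def einterval_def)
    have "set_integrable lebesgue {0<..} f"
      unfolding f_def by (rule absolutely_integrable_Gamma_integral') simp
    thus "set_integrable lborel (einterval 0 \<infinity>) f"
      unfolding set_integrable_def using integrable_completion[OF meas] by (simp add: einterval_def greaterThan_def)
  qed (auto intro!: derivative_eq_intros)
  also have "\<dots> = (\<integral>t. complex_of_real (exp t * exp (- exp t)) * cis (\<tau> * t) \<partial>lborel)"
    unfolding f_exp by (simp add: interval_lebesgue_integral_def set_lebesgue_integral_def einterval_def)
  also have "(LBINT t=0..\<infinity>. f t) = (LINT t:{0<..}|lebesgue. f t)"
    using integral_completion[OF meas]
    by (simp add: interval_lebesgue_integral_def set_lebesgue_integral_def einterval_def greaterThan_def)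
  also have "\<dots> = integral {0<..} f"
    unfolding f_def by (rule set_lebesgue_integral_eq_integral(2) absolutely_integrable_Gamma_integral')+ simp
  also have "\<dots> = Gamma (1 + \<i> * \<tau>)"
    unfolding f_def by (rule integral_unique[OF Gamma_integral_complex']) simp
  finally show ?thesis ..
qed

text \<open>This is the reflection formula \<open>\<Gamma>(z) \<Gamma>(1 - z) = \<pi> / sin (\<pi> z)\<close> at \<open>z = \<i> * \<tau>\<close>.\<close>

lemma Gamma_mult_Gamma_conjugate:
  assumes "\<tau> \<noteq> 0"
  shows "Gamma (1 + \<i> * \<tau>) * Gamma (1 - \<i> * \<tau>) = of_real (pi * \<tau> / sinh (pi * \<tau>))"
proof -
  have "\<i> * complex_of_real \<tau> \<notin> \<int>\<^sub>\<le>\<^sub>0"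
    using assms by (auto elim!: nonpos_Ints_cases simp: complex_eq_iff)
  hence "Gamma (1 + \<i> * \<tau>) = \<i> * \<tau> * Gamma (\<i> * \<tau>)"
    using Gamma_plus1[of "\<i> * \<tau>"] by (simp add: add.commute)
  hence "Gamma (1 + \<i> * \<tau>) * Gamma (1 - \<i> * \<tau>) = \<i> * \<tau> * (Gamma (\<i> * \<tau>) * Gamma (1 - \<i> * \<tau>))"
    by (simp only: mult.assoc)
  also have "\<dots> = \<i> * \<tau> * (of_real pi / sin (of_real pi * (\<i> * \<tau>)))"
    by (simp only: Gamma_reflection_complex)
  also have "sin (of_real pi * (\<i> * \<tau>)) = \<i> * of_real (sinh (pi * \<tau>))"
    by (simp add: sinh_def sin_exp_eq exp_of_real[symmetric] scaleR_conv_of_real field_simps)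
  finally show ?thesis
    by simp
qed

lemma norm_Gamma_squared:
  assumes "\<tau> \<noteq> 0"
  shows "norm (Gamma (1 + \<i> * complex_of_real \<tau>)) ^ 2 = pi * \<tau> / sinh (pi * \<tau>)"
proof -
  have "cnj (Gamma (1 + \<i> * complex_of_real \<tau>)) = Gamma (1 - \<i> * \<tau>)"
    by (simp add: cnj_Gamma)
  hence "complex_of_real (norm (Gamma (1 + \<i> * complex_of_real \<tau>)) ^ 2) = of_real (pi * \<tau> / sinh (pi * \<tau>))"
    using Gamma_mult_Gamma_conjugate[OF assms] by (simp only: complex_norm_square)
  thus ?thesis
    unfolding of_real_eq_iff .
qed

section \<open>A uniform bound for the Macdonald functions\<close>

text \<open>
  Translating \<open>u\<close> by \<open>ln (2 / y)\<close> turns \<open>y * exp u\<close> into \<open>2 * exp t\<close> and costs only a factor of modulus 1.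
  In the limit \<open>y = 0\<close> the Gamma integral in the variable \<open>exp t\<close> appears.
\<close>

lemma norm_macdonald_transform_exp:
  assumes y: "y > 0"
  shows "norm (of_real y * macdonald_transform exp \<tau> y)
    = 2 * norm (\<integral>t. complex_of_real (exp t * exp (- exp t - y\<^sup>2 / 4 * exp (- t))) * cis (\<tau> * t) \<partial>lborel)"
proof -
  define c where "c = ln (2 / y)"
  have exp_c: "exp (t + c) = 2 / y * exp t" "exp (- (t + c)) = y / 2 * exp (- t)" for t
  proof -
    have "exp c = 2 / y" "exp (- c) = y / 2"
      using y by (simp_all add: c_def exp_minus)
    thus "exp (t + c) = 2 / y * exp t" "exp (- (t + c)) = y / 2 * exp (- t)"
      unfolding minus_add_distrib exp_add by simp_all
  qed
  have eq: "complex_of_real (exp (t + c) * exp (- y * cosh (t + c))) * cis (\<tau> * (t + c))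
    = (of_real (2 / y) * cis (\<tau> * c)) *
      (complex_of_real (exp t * exp (- exp t - y\<^sup>2 / 4 * exp (- t))) * cis (\<tau> * t))" for t
  proof -
    have "- y * cosh (t + c) = - exp t - y\<^sup>2 / 4 * exp (- t)"
      using y unfolding cosh_def exp_c by (simp add: field_simps power2_eq_square)
    moreover have "cis (\<tau> * (t + c)) = cis (\<tau> * c) * cis (\<tau> * t)"
      by (simp add: cis_mult algebra_simps)
    ultimately show ?thesis
      unfolding exp_c by simp
  qed
  have "macdonald_transform exp \<tau> y
      = (\<integral>t. complex_of_real (exp (t + c) * exp (- y * cosh (t + c))) * cis (\<tau> * (t + c)) \<partial>lborel)"
    unfolding macdonald_transform_def by (rule integral_translate[symmetric])
  also have "\<dots> = (of_real (2 / y) * cis (\<tau> * c)) *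
      (\<integral>t. complex_of_real (exp t * exp (- exp t - y\<^sup>2 / 4 * exp (- t))) * cis (\<tau> * t) \<partial>lborel)"
    unfolding eq by (rule integral_mult_right_zero)
  finally show ?thesis
    using y by (simp add: norm_mult norm_divide)
qed

lemma macdonald_transform_exp_limit:
  "(\<lambda>k. norm (of_real (1 / real (Suc k)) * macdonald_transform exp \<tau> (1 / real (Suc k))))
     \<longlonglongrightarrow> 2 * norm (Gamma (1 + \<i> * complex_of_real \<tau>))"
proof -
  define s where "s = (\<lambda>k t. complex_of_real (exp t * exp (- exp t - (1 / real (Suc k))\<^sup>2 / 4 * exp (- t))) * cis (\<tau> * t))"
  have "(\<lambda>k. \<integral>t. s k t \<partial>lborel) \<longlonglongrightarrow> (\<integral>t. complex_of_real (exp t * exp (- exp t)) * cis (\<tau> * t) \<partial>lborel)"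
  proof (rule integral_dominated_convergence)
    show "integrable lborel (\<lambda>t::real. exp t * exp (- exp t))"
      using has_bochner_integral_exp_minus_exp by (auto simp: has_bochner_integral_iff)
    show "AE t in lborel. norm (s k t) \<le> exp t * exp (- exp t)" for k
      by (intro AE_I2) (simp add: s_def norm_mult)
    show "AE t in lborel. (\<lambda>k. s k t) \<longlonglongrightarrow> complex_of_real (exp t * exp (- exp t)) * cis (\<tau> * t)"
    proof (intro AE_I2)
      fix t :: real
      have "(\<lambda>k. (1 / real (Suc k))\<^sup>2 / 4 * exp (- t)) \<longlonglongrightarrow> 0"
        by real_asymp
      hence "(\<lambda>k. - exp t - (1 / real (Suc k))\<^sup>2 / 4 * exp (- t)) \<longlonglongrightarrow> - exp t - 0"
        by (intro tendsto_intros)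
      thus "(\<lambda>k. s k t) \<longlonglongrightarrow> complex_of_real (exp t * exp (- exp t)) * cis (\<tau> * t)"
        unfolding s_def by (intro tendsto_intros) simp
    qed
  qed (simp_all add: s_def)
  hence "(\<lambda>k. 2 * norm (\<integral>t. s k t \<partial>lborel)) \<longlonglongrightarrow> 2 * norm (Gamma (1 + \<i> * complex_of_real \<tau>))"
    unfolding integral_exp_minus_exp_cis by (intro tendsto_intros)
  thus ?thesis
    by (subst norm_macdonald_transform_exp) (simp_all add: s_def)
qed

lemma macdonald_moment_squared_le:
  assumes "\<tau> \<noteq> 0" "x > 0"
  shows "(\<tau>\<^sup>2 - x\<^sup>2) * macdonald_moment 0 \<tau> x ^ 2 \<le> 4 * pi * \<tau> / sinh (pi * \<tau>)"
proof -
  have "(\<tau>\<^sup>2 - x\<^sup>2) * macdonald_moment 0 \<tau> x ^ 2 \<le> (2 * norm (Gamma (1 + \<i> * complex_of_real \<tau>)))\<^sup>2"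
  proof (rule tendsto_le[OF trivial_limit_sequentially tendsto_power[OF macdonald_transform_exp_limit] tendsto_const])
    have "(\<lambda>k. 1 / real (Suc k)) \<longlonglongrightarrow> 0"
      by real_asymp
    hence "\<forall>\<^sub>F k in sequentially. 1 / real (Suc k) < x"
      using assms(2) by (rule order_tendstoD)
    thus "\<forall>\<^sub>F k in sequentially. (\<tau>\<^sup>2 - x\<^sup>2) * macdonald_moment 0 \<tau> x ^ 2
            \<le> norm (of_real (1 / real (Suc k)) * macdonald_transform exp \<tau> (1 / real (Suc k))) ^ 2"
      by eventually_elim (intro macdonald_moment_energy_le, auto)
  qed
  thus ?thesis
    using norm_Gamma_squared[OF assms(1)] by (simp add: power_mult_distrib)
qed

text \<open>
  For \<open>x \<le> 9 / 10 * m\<close> the energy controls the Macdonald function. For larger \<open>x\<close> the factor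
  \<open>exp (- pi * m / 2)\<close> is at least \<open>exp (- 5 / 9 * pi * x)\<close> and the trivial bound by a multiple of
  \<open>exp (- x)\<close> suffices, because \<open>5 / 9 * pi - 1 < 4 / 5\<close>.
\<close>

lemma macdonald_moment_uniform_bound:
  obtains C where "C > 0" "\<And>m x. m \<ge> 1 \<Longrightarrow> x > 0 \<Longrightarrow>
    \<bar>macdonald_moment 0 (real m) x\<bar> \<le> C * exp (- pi * real m / 2) * exp (4 / 5 * x)"
proof -
  define K where "K = (\<integral>u. exp (- (9 / 10) * cosh u) \<partial>lborel :: real)"
  have K: "K \<ge> 0"
    unfolding K_def by (intro Bochner_Integration.integral_nonneg) auto
  have intK: "integrable lborel (\<lambda>u::real. exp (- (9 / 10) * cosh u))"
    using integrable_cosh_power_exp[of "9/10" 0] by simp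
  define C where "C = 20 + K * exp (9 / 10)"
  have "\<bar>macdonald_moment 0 (real m) x\<bar> \<le> C * exp (- pi * real m / 2) * exp (4 / 5 * x)"
    if m: "m \<ge> 1" and x: "x > 0" for m :: nat and x :: real
  proof (cases "x \<le> 9 / 10 * real m")
    case True
    let ?t = "real m"
    have t: "?t \<ge> 1" using m by simp
    have "x\<^sup>2 \<le> (9 / 10 * ?t)\<^sup>2"
      using True x by (intro power_mono) auto
    hence "19 / 100 * ?t\<^sup>2 \<le> ?t\<^sup>2 - x\<^sup>2"
      by (simp add: power_mult_distrib field_simps)
    moreover have "?t \<le> ?t\<^sup>2"
      using t by (simp add: power2_eq_square)
    ultimately have "19 / 100 * ?t \<le> ?t\<^sup>2 - x\<^sup>2"
      by linarith
    hence "19 / 100 * ?t * macdonald_moment 0 ?t x ^ 2 \<le> (?t\<^sup>2 - x\<^sup>2) * macdonald_moment 0 ?t x ^ 2"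
      by (intro mult_right_mono) auto
    also have "\<dots> \<le> 4 * pi * ?t / sinh (pi * ?t)"
      using t x by (intro macdonald_moment_squared_le) auto
    finally have "?t * (19 / 100 * macdonald_moment 0 ?t x ^ 2) \<le> ?t * (4 * pi / sinh (pi * ?t))"
      by (simp add: mult_ac)
    hence 1: "19 / 100 * macdonald_moment 0 ?t x ^ 2 \<le> 4 * pi / sinh (pi * ?t)"
      using t by (subst (asm) mult_le_cancel_left_pos) auto
    have "1 \<le> pi * ?t"
      using t pi_gt3 mult_mono[of 1 pi 1 ?t] by simp
    hence "2 \<le> exp (pi * ?t)"
      using exp_ge_add_one_self[of "pi * ?t"] by linarith
    moreover have "exp (- (pi * ?t)) \<le> 1"
      using t by simp
    moreover have "sinh (pi * ?t) = (exp (pi * ?t) - exp (- (pi * ?t))) / 2"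
      by (simp add: sinh_def)
    moreover have "a / 4 \<le> s" if "2 \<le> a" "b \<le> 1" "s = (a - b) / 2" for a b s :: real
      using that by simp
    ultimately have 2: "exp (pi * ?t) / 4 \<le> sinh (pi * ?t)"
      by blast
    have "4 * pi / sinh (pi * ?t) \<le> 4 * pi / (exp (pi * ?t) / 4)"
      by (intro divide_left_mono 2 mult_pos_pos order.strict_trans2[OF _ 2]) auto
    also have "\<dots> = 16 * pi * exp (- pi * ?t)"
      by (simp add: exp_minus field_simps)
    also have "\<dots> \<le> 64 * exp (- pi * ?t)"
      using pi_less_4 by simp
    \<comment> \<open>\<open>64 * (100 / 19) \<le> 400 = 20\<^sup>2\<close>\<close>
    finally have "macdonald_moment 0 ?t x ^ 2 \<le> 400 * exp (- pi * ?t)"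
      using 1 exp_ge_zero[of "- pi * ?t"] by linarith
    also have "exp (- pi * ?t) = exp (- pi * ?t / 2) ^ 2"
      by (simp flip: exp_double)
    also have "400 * exp (- pi * ?t / 2) ^ 2 = (20 * exp (- pi * ?t / 2)) ^ 2"
      by (simp add: power_mult_distrib)
    finally have "\<bar>macdonald_moment 0 ?t x\<bar> \<le> 20 * exp (- pi * ?t / 2) * 1"
      by (subst (asm) abs_le_square_iff[symmetric]) simp
    also have "\<dots> \<le> C * exp (- pi * ?t / 2) * exp (4 / 5 * x)"
      using x K by (intro mult_mono) (auto simp: C_def)
    finally show ?thesis .
  next
    case False
    hence mx: "real m < 10 / 9 * x" and x9: "x > 9 / 10"
      using m by auto
    have "\<bar>macdonald_moment 0 (real m) x\<bar> \<le> (\<integral>u. exp (- (x - 9 / 10)) * exp (- (9 / 10) * cosh u) \<partial>lborel)"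
      unfolding macdonald_moment_eq_integral[OF x]
    proof (rule integral_abs_bound_integral)
      show "integrable lborel (\<lambda>u. (cosh u ^ 0 * cos (real m * u)) * exp (- x * cosh u))"
        by (rule integrable_mult_exp_cosh[OF x _ abs_cosh_power_mult_cos_le]) measurable
      show "integrable lborel (\<lambda>u::real. exp (- (x - 9 / 10)) * exp (- (9 / 10) * cosh u))"
        using intK by (rule integrable_mult_right)
      fix u :: real
      have "(x - 9 / 10) * 1 \<le> (x - 9 / 10) * cosh u"
        using x9 cosh_real_ge_1[of u] by (intro mult_left_mono) auto
      hence "exp (- x * cosh u) \<le> exp (- (x - 9 / 10) + - (9 / 10) * cosh u)"
        by (simp add: algebra_simps)
      hence "exp (- x * cosh u) \<le> exp (- (x - 9 / 10)) * exp (- (9 / 10) * cosh u)"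
        by (simp only: exp_add)
      moreover have "\<bar>(cosh u ^ 0 * cos (real m * u)) * exp (- x * cosh u)\<bar> \<le> 1 * exp (- x * cosh u)"
        unfolding abs_mult by (intro mult_mono) auto
      ultimately show "\<bar>(cosh u ^ 0 * cos (real m * u)) * exp (- x * cosh u)\<bar>
          \<le> exp (- (x - 9 / 10)) * exp (- (9 / 10) * cosh u)"
        by linarith
    qed
    also have "\<dots> = exp (- (x - 9 / 10)) * K"
      by (simp add: K_def)
    also have "\<dots> = (K * exp (9 / 10)) * exp (- x)"
    proof -
      have "exp (- (x - 9 / 10)) = exp (9 / 10) * exp (- x)"
        unfolding exp_add[symmetric] by simp
      thus ?thesis by simp
    qed
    also have "\<dots> \<le> C * (exp (- pi * real m / 2) * exp (4 / 5 * x))"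
    proof (intro mult_mono)
      have "pi * real m \<le> 3.24 * (10 / 9 * x)"
        using mx x pi_approx(2) by (intro mult_mono) auto
      hence "- x \<le> - pi * real m / 2 + 4 / 5 * x"
        by simp
      thus "exp (- x) \<le> exp (- pi * real m / 2) * exp (4 / 5 * x)"
        unfolding exp_add[symmetric] by (simp only: exp_le_cancel_iff)
    qed (use K in \<open>auto simp: C_def\<close>)
    finally show ?thesis
      by (simp only: mult.assoc)
  qed
  moreover have "C > 0"
    using K by (auto simp: C_def intro!: add_pos_nonneg)
  ultimately show ?thesis
    using that by blast
qed

section \<open>The Fourier transform of \<open>1 / (cosh u + cosh v)\<close>\<close>

lemma integral_exp_double_minus_exp:
  assumes c: "c > (0::real)"
  shows "(\<integral>t. exp (2 * t) * exp (- c * exp t) \<partial>lborel) = 1 / c\<^sup>2"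
proof -
  have "has_bochner_integral lborel (\<lambda>t. exp (2 * t) * exp (- c * exp t)) (0 - (- 1 / c\<^sup>2))"
  proof (rule has_bochner_integral_real_line_FTC_nonneg[where F = "\<lambda>t. - (exp t / c + 1 / c\<^sup>2) * exp (- c * exp t)"])
    show "((\<lambda>t. - (exp t / c + 1 / c\<^sup>2) * exp (- c * exp t)) \<longlongrightarrow> - 1 / c\<^sup>2) at_bot"
    proof -
      have "((\<lambda>t. - (exp t / c + 1 / c\<^sup>2) * exp (- c * exp t)) \<longlongrightarrow> - (0 / c + 1 / c\<^sup>2) * exp (- c * 0)) at_bot"
        using c by (intro tendsto_intros exp_at_bot) auto
      thus ?thesis by simp
    qed
    show "((\<lambda>t. - (exp t / c + 1 / c\<^sup>2) * exp (- c * exp t)) \<longlongrightarrow> 0) at_top"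
      using c by real_asymp
    show "((\<lambda>t. - (exp t / c + 1 / c\<^sup>2) * exp (- c * exp t)) has_real_derivative
            exp (2 * t) * exp (- c * exp t)) (at t)" for t
    proof -
      have "exp (2 * t) = exp t * exp t"
        by (simp flip: exp_add)
      thus ?thesis
        using c by (auto intro!: derivative_eq_intros simp: field_simps power2_eq_square)
    qed
  qed auto
  thus ?thesis
    by (simp add: has_bochner_integral_iff)
qed

text \<open>
  The product of the Gamma integrals at \<open>1 + \<i> * \<tau>\<close> and \<open>1 - \<i> * \<tau>\<close> is a double integral. After a
  translation its inner integral is elementary, and half of the transform of \<open>1 / (1 + cosh v)\<close>, a Beta
  integral in logarithmic coordinates, remains.
\<close>

lemma integral_inverse_1_plus_cosh_cis:
  assumes "\<tau> \<noteq> 0"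
  shows "(\<integral>v. complex_of_real (1 / (1 + cosh v)) * cis (\<tau> * v) \<partial>lborel)
           = of_real (2 * pi * \<tau> / sinh (pi * \<tau>))"
proof -
  define F where "F = (\<lambda>\<tau> t. complex_of_real (exp t * exp (- exp t)) * cis (\<tau> * t))"
  define f where "f = (\<lambda>t v. F \<tau> (v + t) * F (- \<tau>) t)"
  have intF: "integrable lborel (F \<tau>)" for \<tau>
    unfolding F_def by (rule integrable_exp_minus_exp_cis)
  have [measurable]: "F \<tau> \<in> borel_measurable borel" for \<tau>
    unfolding F_def by measurable
  have "integrable (lborel \<Otimes>\<^sub>M lborel) (case_prod f)"
  proof (rule lborel_pair.Fubini_integrable)
    have "(\<integral>v. norm (f t v) \<partial>lborel) = norm (F (- \<tau>) t) * (\<integral>v. norm (F \<tau> v) \<partial>lborel)" for t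
      using integral_translate[of "\<lambda>v. norm (F \<tau> v)" t] by (simp add: f_def norm_mult mult.commute)
    thus "integrable lborel (\<lambda>t. \<integral>v. norm (case_prod f (t, v)) \<partial>lborel)"
      using intF[of "- \<tau>"] by (simp add: integrable_norm)
    show "AE t in lborel. integrable lborel (\<lambda>v. case_prod f (t, v))"
      unfolding f_def by (auto intro!: AE_I2 integrable_translate intF)
  qed (simp add: f_def)
  hence "(\<integral>v. (\<integral>t. f t v \<partial>lborel) \<partial>lborel) = (\<integral>t. (\<integral>v. f t v \<partial>lborel) \<partial>lborel)"
    by (rule lborel_pair.Fubini_integral)
  also have "(\<lambda>t. \<integral>v. f t v \<partial>lborel) = (\<lambda>t. (\<integral>v. F \<tau> v \<partial>lborel) * F (- \<tau>) t)"
    unfolding f_def using integral_translate[of "F \<tau>"] by simp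
  also have "(\<integral>t. (\<integral>v. F \<tau> v \<partial>lborel) * F (- \<tau>) t \<partial>lborel) = (\<integral>v. F \<tau> v \<partial>lborel) * (\<integral>t. F (- \<tau>) t \<partial>lborel)"
    by (rule integral_mult_right_zero)
  also have "\<dots> = Gamma (1 + \<i> * \<tau>) * Gamma (1 - \<i> * \<tau>)"
    using integral_exp_minus_exp_cis[of \<tau>] integral_exp_minus_exp_cis[of "- \<tau>"] by (simp add: F_def)
  also have "\<dots> = of_real (pi * \<tau> / sinh (pi * \<tau>))"
    by (rule Gamma_mult_Gamma_conjugate[OF assms])
  also have "(\<lambda>v. \<integral>t. f t v \<partial>lborel) = (\<lambda>v. (1 / 2) * (complex_of_real (1 / (1 + cosh v)) * cis (\<tau> * v)))"
  proof
    fix v :: real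
    have eq: "f t v = (of_real (exp v) * cis (\<tau> * v)) * complex_of_real (exp (2 * t) * exp (- (1 + exp v) * exp t))" for t
    proof -
      have "f t v = of_real ((exp (v + t) * exp (- exp (v + t))) * (exp t * exp (- exp t))) *
                      (cis (\<tau> * (v + t)) * cis (- \<tau> * t))"
        by (simp add: f_def F_def mult_ac)
      also have "cis (\<tau> * (v + t)) * cis (- \<tau> * t) = cis (\<tau> * v)"
        by (simp add: cis_mult algebra_simps)
      also have "(exp (v + t) * exp (- exp (v + t))) * (exp t * exp (- exp t))
                  = exp v * (exp (2 * t) * exp (- (1 + exp v) * exp t))"
        by (simp add: algebra_simps flip: exp_add)
      finally show ?thesis
        by simp
    qed
    have "(\<integral>t. f t v \<partial>lborel) = (of_real (exp v) * cis (\<tau> * v)) *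
            (\<integral>t. complex_of_real (exp (2 * t) * exp (- (1 + exp v) * exp t)) \<partial>lborel)"
      unfolding eq by (rule integral_mult_right_zero)
    also have "(\<integral>t. complex_of_real (exp (2 * t) * exp (- (1 + exp v) * exp t)) \<partial>lborel)
        = of_real (\<integral>t. exp (2 * t) * exp (- (1 + exp v) * exp t) \<partial>lborel)"
      by (rule integral_complex_of_real)
    also have "(\<integral>t. exp (2 * t) * exp (- (1 + exp v) * exp t) \<partial>lborel) = 1 / (1 + exp v)\<^sup>2"
      by (rule integral_exp_double_minus_exp) (simp add: add_pos_pos)
    also have "(of_real (exp v) * cis (\<tau> * v)) * complex_of_real (1 / (1 + exp v)\<^sup>2)
        = of_real (exp v / (1 + exp v)\<^sup>2) * cis (\<tau> * v)"
      by simp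
    also have "exp v / (1 + exp v)\<^sup>2 = 1 / (2 * (1 + cosh v))"
    proof -
      have "exp v * (2 * (1 + cosh v)) = (1 + exp v)\<^sup>2"
        by (simp add: cosh_def algebra_simps power2_eq_square flip: exp_add)
      thus ?thesis
        using cosh_real_ge_1[of v] by (intro frac_eq_eq[THEN iffD2]) (auto simp: add_nonneg_eq_0_iff)
    qed
    finally show "(\<integral>t. f t v \<partial>lborel) = (1 / 2) * (complex_of_real (1 / (1 + cosh v)) * cis (\<tau> * v))"
      by simp
  qed
  also have "(\<integral>v. (1 / 2) * (complex_of_real (1 / (1 + cosh v)) * cis (\<tau> * v)) \<partial>lborel)
      = (1 / 2) * (\<integral>v. complex_of_real (1 / (1 + cosh v)) * cis (\<tau> * v) \<partial>lborel)"
    by (rule integral_mult_right_zero)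
  finally show ?thesis
    by simp
qed

lemma tanh_diff_eq:
  "tanh ((v + u) / 2) - tanh ((v - u) / 2) = 2 * sinh u / (cosh u + cosh (v::real))"
proof -
  let ?a = "(v + u) / 2" and ?b = "(v - u) / 2"
  have u: "?a - ?b = u" and v: "?a + ?b = v"
    by (simp_all add: field_simps)
  have "2 * (cosh ?a * cosh ?b) = cosh (?a - ?b) + cosh (?a + ?b)"
    by (simp add: cosh_add cosh_diff)
  hence c: "2 * (cosh ?a * cosh ?b) = cosh u + cosh v"
    unfolding u v .
  have "tanh ?a - tanh ?b = sinh (?a - ?b) / (cosh ?a * cosh ?b)"
    unfolding tanh_def sinh_diff by (simp add: diff_frac_eq mult_ac)
  also have "\<dots> = 2 * sinh u / (2 * (cosh ?a * cosh ?b))"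
    unfolding u by simp
  finally show ?thesis
    unfolding c .
qed

text \<open>
  By \<open>tanh_diff_eq\<close> the function \<open>2 * sinh u / (cosh u + cosh v)\<close> of \<open>v\<close> is the integral over
  \<open>w \<in> {-u..u}\<close> of the translates \<open>1 / (1 + cosh (v + w))\<close>, whose Fourier transforms are known.
\<close>

lemma integral_inverse_cosh_plus_cosh_cis:
  assumes u: "u > 0" and \<tau>: "\<tau> \<noteq> 0"
  shows "(\<integral>v. complex_of_real (1 / (cosh u + cosh v)) * cis (\<tau> * v) \<partial>lborel)
           = of_real (2 * pi * sin (\<tau> * u) / (sinh u * sinh (pi * \<tau>)))"
proof -
  define f where
    "f = (\<lambda>w v. indicator {-u..u} w *\<^sub>R (complex_of_real (1 / (1 + cosh (v + w))) * cis (\<tau> * v)))"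
  have intS: "integrable lborel (\<lambda>v::real. 1 / (1 + cosh v))" "(\<integral>v. 1 / (1 + cosh v) \<partial>lborel) = (2::real)"
    using has_bochner_integral_inverse_1_plus_cosh by (auto simp: has_bochner_integral_iff)
  have norm_f: "norm (f w v) = indicator {-u..u} w * (1 / (1 + cosh (v + w)))" for w v
    unfolding f_def norm_scaleR norm_mult norm_of_real norm_cis
    using cosh_real_ge_1[of "v + w"] by simp
  have "integrable (lborel \<Otimes>\<^sub>M lborel) (case_prod f)"
  proof (rule lborel_pair.Fubini_integrable)
    have "(\<integral>v. norm (f w v) \<partial>lborel) = indicator {-u..u} w * 2" for w
      unfolding norm_f integral_mult_right_zero
      using integral_translate[of "\<lambda>v. 1 / (1 + cosh v) :: real" w] intS(2) by simp
    thus "integrable lborel (\<lambda>w. \<integral>v. norm (case_prod f (w, v)) \<partial>lborel)"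
      by (auto intro!: integrable_real_indicator simp: emeasure_lborel_Icc_eq)
    show "AE w in lborel. integrable lborel (\<lambda>v. case_prod f (w, v))"
    proof (intro AE_I2)
      fix w :: real
      have "integrable lborel (\<lambda>v. norm (f w v))"
        unfolding norm_f by (rule integrable_mult_right[OF integrable_translate[OF intS(1)]])
      thus "integrable lborel (\<lambda>v. case_prod f (w, v))"
        by (subst (asm) integrable_norm_iff) (simp_all add: f_def)
    qed
  qed (simp add: f_def)
  hence "(\<integral>v. (\<integral>w. f w v \<partial>lborel) \<partial>lborel) = (\<integral>w. (\<integral>v. f w v \<partial>lborel) \<partial>lborel)"
    by (rule lborel_pair.Fubini_integral)
  also have "(\<lambda>v. \<integral>w. f w v \<partial>lborel)
      = (\<lambda>v. of_real (2 * sinh u) * (complex_of_real (1 / (cosh u + cosh v)) * cis (\<tau> * v)))"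
  proof
    fix v :: real
    have "has_bochner_integral lborel (\<lambda>w. indicator {-u..u} w *\<^sub>R (1 / (1 + cosh (v + w))))
            (tanh ((v + u) / 2) - tanh ((v + - u) / 2))"
    proof (rule has_bochner_integral_FTC_Icc)
      show "((\<lambda>w. tanh ((v + w) / 2)) has_vector_derivative 1 / (1 + cosh (v + w))) (at w within {-u..u})" for w
        using has_real_derivative_tanh_half by (simp add: has_real_derivative_iff_has_vector_derivative)
      show "continuous_on {-u..u} (\<lambda>w. 1 / (1 + cosh (v + w)))"
        using cosh_real_ge_1 by (intro continuous_intros) (auto simp: add_nonneg_eq_0_iff)
    qed (use u in simp)
    hence "(\<integral>w. indicator {-u..u} w *\<^sub>R (1 / (1 + cosh (v + w))) \<partial>lborel) = 2 * sinh u / (cosh u + cosh v)"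
      using tanh_diff_eq[of v u] by (simp add: has_bochner_integral_iff)
    hence *: "(\<integral>w. complex_of_real (indicator {-u..u} w *\<^sub>R (1 / (1 + cosh (v + w)))) \<partial>lborel)
        = of_real (2 * sinh u / (cosh u + cosh v))"
      by (simp only: integral_complex_of_real)
    have eq: "f w v = complex_of_real (indicator {-u..u} w *\<^sub>R (1 / (1 + cosh (v + w)))) * cis (\<tau> * v)" for w
      by (simp add: f_def scaleR_conv_of_real)
    have "(\<integral>w. f w v \<partial>lborel) = of_real (2 * sinh u / (cosh u + cosh v)) * cis (\<tau> * v)"
      unfolding eq integral_mult_left_zero * ..
    thus "(\<integral>w. f w v \<partial>lborel) = of_real (2 * sinh u) * (complex_of_real (1 / (cosh u + cosh v)) * cis (\<tau> * v))"
      by simp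
  qed
  also have "(\<integral>v. of_real (2 * sinh u) * (complex_of_real (1 / (cosh u + cosh v)) * cis (\<tau> * v)) \<partial>lborel)
      = of_real (2 * sinh u) * (\<integral>v. complex_of_real (1 / (cosh u + cosh v)) * cis (\<tau> * v) \<partial>lborel)"
    by (rule integral_mult_right_zero)
  also have "(\<lambda>w. \<integral>v. f w v \<partial>lborel)
      = (\<lambda>w. of_real (2 * pi * \<tau> / sinh (pi * \<tau>)) * (indicator {-u..u} w *\<^sub>R cis (- \<tau> * w)))"
  proof
    fix w :: real
    have eq: "f w v = (indicator {-u..u} w *\<^sub>R cis (- \<tau> * w)) *
                  (complex_of_real (1 / (1 + cosh (v + w))) * cis (\<tau> * (v + w)))" for v
    proof -
      have "cis (\<tau> * v) = cis (- \<tau> * w) * cis (\<tau> * (v + w))"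
        by (simp add: cis_mult algebra_simps)
      thus ?thesis
        by (simp add: f_def scaleR_conv_of_real)
    qed
    have "(\<integral>v. complex_of_real (1 / (1 + cosh (v + w))) * cis (\<tau> * (v + w)) \<partial>lborel)
        = of_real (2 * pi * \<tau> / sinh (pi * \<tau>))"
      using integral_translate[of "\<lambda>v. complex_of_real (1 / (1 + cosh v)) * cis (\<tau> * v)" w]
        integral_inverse_1_plus_cosh_cis[OF \<tau>] by (simp only:)
    thus "(\<integral>v. f w v \<partial>lborel)
        = of_real (2 * pi * \<tau> / sinh (pi * \<tau>)) * (indicator {-u..u} w *\<^sub>R cis (- \<tau> * w))"
      unfolding eq integral_mult_right_zero by (simp only: mult.commute)
  qed
  also have "(\<integral>w. of_real (2 * pi * \<tau> / sinh (pi * \<tau>)) * (indicator {-u..u} w *\<^sub>R cis (- \<tau> * w)) \<partial>lborel)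
      = of_real (2 * pi * \<tau> / sinh (pi * \<tau>)) * (\<integral>w. indicator {-u..u} w *\<^sub>R cis (- \<tau> * w) \<partial>lborel)"
    by (rule integral_mult_right_zero)
  also have "(\<integral>w. indicator {-u..u} w *\<^sub>R cis (- \<tau> * w) \<partial>lborel) = of_real (2 * sin (\<tau> * u) / \<tau>)"
  proof -
    have "has_bochner_integral lborel (\<lambda>w. indicator {-u..u} w *\<^sub>R cis (- \<tau> * w))
            (\<i> / \<tau> * cis (- \<tau> * u) - \<i> / \<tau> * cis (- \<tau> * - u))"
    proof (rule has_bochner_integral_FTC_Icc)
      show "((\<lambda>w. \<i> / \<tau> * cis (- \<tau> * w)) has_vector_derivative cis (- \<tau> * w)) (at w within {-u..u})" for w
        using \<tau> by (auto simp: has_vector_derivative_complex_iff intro!: derivative_eq_intros)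
      show "continuous_on {-u..u} (\<lambda>w. cis (- \<tau> * w))"
        by (intro continuous_intros)
    qed (use u in simp)
    moreover have "\<i> / \<tau> * cis (- \<tau> * u) - \<i> / \<tau> * cis (- \<tau> * - u) = of_real (2 * sin (\<tau> * u) / \<tau>)"
      using \<tau> by (simp add: complex_eq_iff Re_divide Im_divide power2_eq_square)
    ultimately show ?thesis
      by (simp add: has_bochner_integral_iff)
  qed
  finally have "complex_of_real (2 * sinh u) * (\<integral>v. complex_of_real (1 / (cosh u + cosh v)) * cis (\<tau> * v) \<partial>lborel)
     = complex_of_real (2 * pi * \<tau> / sinh (pi * \<tau>)) * of_real (2 * sin (\<tau> * u) / \<tau>)" .
  also have "\<dots> = complex_of_real (2 * sinh u) * of_real (2 * pi * sin (\<tau> * u) / (sinh u * sinh (pi * \<tau>)))"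
    unfolding of_real_mult[symmetric] of_real_eq_iff using u \<tau> by (simp add: field_simps)
  finally show ?thesis
    using u by (subst (asm) mult_left_cancel) auto
qed

section \<open>The Laplace transform of the Macdonald functions\<close>

lemma integrable_inverse_cosh_plus_cosh:
  "integrable lborel (\<lambda>v::real. 1 / (cosh u + cosh v))" for u :: real
proof -
  have "integrable lborel (\<lambda>v::real. 1 / (1 + cosh v))"
    using has_bochner_integral_inverse_1_plus_cosh by (auto simp: has_bochner_integral_iff)
  moreover have "(\<lambda>v. 1 / (cosh u + cosh v)) \<in> borel_measurable lborel"
    by measurable
  moreover have "norm (1 / (cosh u + cosh v)) \<le> norm (1 / (1 + cosh v))" for v
    using cosh_real_ge_1[of u] cosh_real_ge_1[of v] by (simp add: frac_le)
  ultimately show ?thesis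
    by (rule Bochner_Integration.integrable_bound[OF _ _ AE_I2])
qed

lemma integral_cos_inverse_cosh_plus_cosh:
  assumes "u > 0" "\<tau> \<noteq> 0"
  shows "(\<integral>v. cos (\<tau> * v) * (1 / (cosh u + cosh v)) \<partial>lborel)
           = 2 * pi * sin (\<tau> * u) / (sinh u * sinh (pi * \<tau>))"
proof -
  have "integrable lborel (\<lambda>v. complex_of_real (1 / (cosh u + cosh v)) * cis (\<tau> * v))"
  proof (rule Bochner_Integration.integrable_bound[OF integrable_inverse_cosh_plus_cosh[of u]])
    show "AE v in lborel. norm (complex_of_real (1 / (cosh u + cosh v)) * cis (\<tau> * v))
            \<le> norm (1 / (cosh u + cosh v))"
      unfolding norm_mult norm_of_real norm_cis by simp
  qed measurable
  from integral_Re[OF this] show ?thesis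
    unfolding integral_inverse_cosh_plus_cosh_cis[OF assms]
    by (simp add: mult.commute)
qed

lemma has_bochner_integral_exp_decay:
  assumes c: "c > (0::real)"
  shows "has_bochner_integral lborel (\<lambda>x. indicator {0<..} x * exp (- x * c)) (1 / c)"
proof -
  let ?F = "\<lambda>x. - exp (- x * c) / c"
  have "((?F \<circ> real_of_ereal) \<longlongrightarrow> - 1 / c) (at_right 0)"
    unfolding zero_ereal_def ereal_tendsto_simps
    using c by (intro tendsto_eq_intros | simp)+
  moreover have "((?F \<circ> real_of_ereal) \<longlongrightarrow> 0) (at_left \<infinity>)"
    unfolding ereal_tendsto_simps using c by real_asymp
  moreover have "(?F has_real_derivative exp (- x * c)) (at x)" for x
    using c by (auto intro!: derivative_eq_intros)
  ultimately have "set_integrable lborel (einterval 0 \<infinity>) (\<lambda>x. exp (- x * c))"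
    "(LBINT x=0..\<infinity>. exp (- x * c)) = 0 - (- 1 / c)"
    by (intro interval_integral_FTC_nonneg[where F = ?F]; simp)+
  thus ?thesis
    by (simp add: has_bochner_integral_iff set_integrable_def interval_lebesgue_integral_def
        set_lebesgue_integral_def einterval_def greaterThan_def)
qed

lemma borel_measurable_macdonald_moment [measurable]:
  "(\<lambda>x. indicator {0<..} x * macdonald_moment j \<tau> x) \<in> borel_measurable borel"
proof -
  have "continuous_on {0<..} (macdonald_moment j \<tau>)"
    by (rule DERIV_continuous_on[OF has_field_derivative_at_within[OF has_real_derivative_macdonald_moment]]) auto
  from borel_measurable_continuous_on_indicator[OF _ this] show ?thesis
    by simp
qed

lemma laplace_transform_macdonald_moment:
  assumes u: "u > 0" and \<tau>: "\<tau> \<noteq> 0"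
  shows "(\<integral>x. exp (- x * cosh u) * (indicator {0<..} x * macdonald_moment 0 \<tau> x) \<partial>lborel)
           = 2 * pi * sin (\<tau> * u) / (sinh u * sinh (pi * \<tau>))"
proof -
  define f where "f = (\<lambda>v x. cos (\<tau> * v) * (indicator {0<..} x * exp (- x * (cosh u + cosh v))))"
  have pos: "cosh u + cosh v > 0" for v
    by (intro add_pos_pos) auto
  have int: "integrable lborel (\<lambda>x. indicator {0<..} x * exp (- x * (cosh u + cosh v)))"
    "(\<integral>x. indicator {0<..} x * exp (- x * (cosh u + cosh v)) \<partial>lborel) = 1 / (cosh u + cosh v)" for v
    using has_bochner_integral_exp_decay[OF pos, of v] unfolding has_bochner_integral_iff by blast+
  have f_meas [measurable]: "case_prod f \<in> borel_measurable (lborel \<Otimes>\<^sub>M lborel)"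
    unfolding f_def by measurable
  have "integrable (lborel \<Otimes>\<^sub>M lborel) (case_prod f)"
  proof (rule lborel_pair.Fubini_integrable)
    have norm_f: "norm (f v x) = \<bar>cos (\<tau> * v)\<bar> * (indicator {0<..} x * exp (- x * (cosh u + cosh v)))" for v x
      by (simp add: f_def abs_mult)
    have "(\<integral>x. norm (f v x) \<partial>lborel) = \<bar>cos (\<tau> * v)\<bar> * (1 / (cosh u + cosh v))" for v
      unfolding norm_f integral_mult_right_zero int ..
    moreover have "integrable lborel (\<lambda>v. \<bar>cos (\<tau> * v)\<bar> * (1 / (cosh u + cosh v)))"
    proof (rule Bochner_Integration.integrable_bound[OF integrable_inverse_cosh_plus_cosh[of u]])
      show "AE v in lborel. norm (\<bar>cos (\<tau> * v)\<bar> * (1 / (cosh u + cosh v))) \<le> norm (1 / (cosh u + cosh v))"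
        unfolding norm_mult by (intro AE_I2 mult_left_le_one_le) auto
    qed measurable
    ultimately show "integrable lborel (\<lambda>v. \<integral>x. norm (case_prod f (v, x)) \<partial>lborel)"
      by simp
    show "AE v in lborel. integrable lborel (\<lambda>x. case_prod f (v, x))"
      unfolding f_def prod.case by (intro AE_I2 integrable_mult_right int)
  qed measurable
  hence "(\<integral>x. (\<integral>v. f v x \<partial>lborel) \<partial>lborel) = (\<integral>v. (\<integral>x. f v x \<partial>lborel) \<partial>lborel)"
    by (rule lborel_pair.Fubini_integral)
  also have "(\<lambda>v. \<integral>x. f v x \<partial>lborel) = (\<lambda>v. cos (\<tau> * v) * (1 / (cosh u + cosh v)))"
    unfolding f_def integral_mult_right_zero int ..
  also have "(\<integral>v. cos (\<tau> * v) * (1 / (cosh u + cosh v)) \<partial>lborel)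
      = 2 * pi * sin (\<tau> * u) / (sinh u * sinh (pi * \<tau>))"
    by (rule integral_cos_inverse_cosh_plus_cosh[OF assms])
  also have "(\<lambda>x. \<integral>v. f v x \<partial>lborel)
      = (\<lambda>x. exp (- x * cosh u) * (indicator {0<..} x * macdonald_moment 0 \<tau> x))"
  proof
    fix x :: real
    show "(\<integral>v. f v x \<partial>lborel) = exp (- x * cosh u) * (indicator {0<..} x * macdonald_moment 0 \<tau> x)"
    proof (cases "x > 0")
      case True
      have "f v x = exp (- x * cosh u) * ((cosh v ^ 0 * cos (\<tau> * v)) * exp (- x * cosh v))" for v
        using True by (simp add: f_def algebra_simps exp_diff exp_minus field_simps)
      thus ?thesis
        using True by (simp add: macdonald_moment_eq_integral)
    qed (simp add: f_def)
  qed
  finally show ?thesis .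
qed

section \<open>Biorthogonality\<close>

text \<open>For \<open>n \<ge> 1\<close>, an integration by parts turns the incomplete Bessel function of order \<open>\<i> * n\<close> at \<open>x\<close>
  into \<open>x / n\<close> times the following integral, which has no singularity at \<open>x = 0\<close>.\<close>

definition sine_kernel :: "nat \<Rightarrow> real \<Rightarrow> real" where
  "sine_kernel n x = (\<integral>u. indicator {0..pi} u * (sinh u * sin (real n * u)) * exp (- x * cosh u) \<partial>lborel)"

lemma incomplete_J_eq_sine_kernel:
  assumes n: "n \<ge> 1"
  shows "incomplete_J (complex_of_real x) (\<i> * of_nat n) pi = of_real (x / real n * sine_kernel n x)"
proof -
  define F where "F = (\<lambda>u. exp (- x * cosh u) * sin (real n * u))"
  define A where "A = (\<lambda>u. indicator {0..pi} u * (sinh u * sin (real n * u)) * exp (- x * cosh u))"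
  define B where "B = (\<lambda>u. indicator {0..pi} u *\<^sub>R (exp (- x * cosh u) * cos (real n * u)))"
  have sk: "sine_kernel n x = (\<integral>u. A u \<partial>lborel)"
    by (simp only: sine_kernel_def A_def)
  have intA: "integrable lborel A"
  proof -
    have "integrable lborel (\<lambda>u. indicator {0..pi} u *\<^sub>R (sinh u * sin (real n * u) * exp (- x * cosh u)))"
      by (rule borel_integrable_compact) (auto intro!: continuous_intros)
    thus ?thesis
      by (simp add: A_def mult.assoc)
  qed
  have intB: "integrable lborel B"
    unfolding B_def by (rule borel_integrable_compact) (auto intro!: continuous_intros)
  have "has_bochner_integral lborel (\<lambda>u. indicator {0..pi} u *\<^sub>R
     (real n * (exp (- x * cosh u) * cos (real n * u)) - x * (sinh u * sin (real n * u) * exp (- x * cosh u))))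
     (F pi - F 0)"
  proof (rule has_bochner_integral_FTC_Icc)
    show "(F has_vector_derivative (real n * (exp (- x * cosh u) * cos (real n * u))
        - x * (sinh u * sin (real n * u) * exp (- x * cosh u)))) (at u within {0..pi})" for u
      unfolding F_def has_real_derivative_iff_has_vector_derivative[symmetric]
      by (auto intro!: derivative_eq_intros)
  qed (auto intro!: continuous_intros)
  moreover have "F pi - F 0 = 0"
    by (simp add: F_def)
  ultimately have "(\<integral>u. real n * B u - x * A u \<partial>lborel) = 0"
    by (simp add: has_bochner_integral_iff A_def B_def algebra_simps)
  hence "real n * (\<integral>u. B u \<partial>lborel) = x * sine_kernel n x"
    using intA intB by (simp add: sk)
  hence *: "(\<integral>u. B u \<partial>lborel) = x / real n * sine_kernel n x"
    using n by (simp add: field_simps)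
  have "cosh (\<i> * of_nat n * complex_of_real u) = of_real (cos (real n * u))" for u
    by (simp add: cosh_conv_cos cos_of_real[symmetric] algebra_simps)
  hence "incomplete_J (complex_of_real x) (\<i> * of_nat n) pi = (\<integral>u. complex_of_real (B u) \<partial>lborel)"
    unfolding incomplete_J_def set_lebesgue_integral_def B_def
    by (intro Bochner_Integration.integral_cong)
      (auto simp: scaleR_conv_of_real simp flip: exp_of_real)
  thus ?thesis
    unfolding integral_complex_of_real * .
qed

lemma borel_measurable_sine_kernel [measurable]: "sine_kernel n \<in> borel_measurable borel"
  unfolding sine_kernel_def by measurable

lemma abs_sine_kernel_le:
  assumes x: "x \<ge> 0"
  shows "\<bar>sine_kernel n x\<bar> \<le> pi * cosh pi * exp (- x)"
proof -
  have "\<bar>sine_kernel n x\<bar> \<le> (\<integral>u. indicator {0..pi} u * (cosh pi * exp (- x)) \<partial>lborel)"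
    unfolding sine_kernel_def
  proof (rule integral_abs_bound_integral)
    have "integrable lborel (\<lambda>u. indicator {0..pi} u *\<^sub>R (sinh u * sin (real n * u) * exp (- x * cosh u)))"
      by (rule borel_integrable_compact) (auto intro!: continuous_intros)
    thus "integrable lborel (\<lambda>u. indicator {0..pi} u * (sinh u * sin (real n * u)) * exp (- x * cosh u))"
      by (simp add: mult.assoc)
    show "integrable lborel (\<lambda>u. indicator {0..pi} u * (cosh pi * exp (- x)))"
      by (intro integrable_mult_left integrable_real_indicator) auto
    show "\<bar>indicator {0..pi} u * (sinh u * sin (real n * u)) * exp (- x * cosh u)\<bar>
            \<le> indicator {0..pi} u * (cosh pi * exp (- x))" for u
    proof (cases "u \<in> {0..pi}")
      case True
      have "cosh u \<le> cosh pi"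
        using True by (simp add: cosh_real_nonneg_le_iff)
      hence s: "\<bar>sinh u\<bar> \<le> cosh pi"
        using abs_sinh_le_cosh[of u] by linarith
      hence "\<bar>sinh u\<bar> * \<bar>sin (real n * u)\<bar> \<le> cosh pi * 1"
        by (intro mult_mono) auto
      moreover have "x * 1 \<le> x * cosh u"
        using x cosh_real_ge_1[of u] by (intro mult_left_mono) auto
      ultimately have "(\<bar>sinh u\<bar> * \<bar>sin (real n * u)\<bar>) * exp (- x * cosh u) \<le> (cosh pi * 1) * exp (- x)"
        using s by (intro mult_mono) auto
      thus ?thesis
        using True by (simp add: abs_mult)
    qed simp
  qed
  also have "\<dots> = pi * cosh pi * exp (- x)"
    by simp
  finally show ?thesis .
qed

lemma integral_sin_mult_sin:
  assumes "n \<ge> 1" "m \<ge> 1"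
  shows "(\<integral>u. indicator {0..pi} u *\<^sub>R (sin (real n * u) * sin (real m * u)) \<partial>lborel)
           = (if m = n then pi / 2 else 0)"
proof -
  have sin_pi: "sin (real k * pi) = 0" for k
    by (rule sin_npi)
  have prod: "sin (real n * u) * sin (real m * u)
      = (cos ((real n - real m) * u) - cos ((real n + real m) * u)) / 2" for u
    by (simp only: sin_times_sin left_diff_distrib distrib_right)
  have "has_bochner_integral lborel (\<lambda>u. indicator {0..pi} u *\<^sub>R (sin (real n * u) * sin (real m * u)))
          (if m = n then pi / 2 else 0)"
  proof (cases "m = n")
    case True
    define F where "F = (\<lambda>u. u / 2 - sin ((real n + real m) * u) / (2 * (real n + real m)))"
    have "has_bochner_integral lborel (\<lambda>u. indicator {0..pi} u *\<^sub>R (sin (real n * u) * sin (real m * u)))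
            (F pi - F 0)"
      unfolding prod
    proof (rule has_bochner_integral_FTC_Icc)
      show "(F has_vector_derivative (cos ((real n - real m) * u) - cos ((real n + real m) * u)) / 2)
              (at u within {0..pi})" for u
        unfolding F_def has_real_derivative_iff_has_vector_derivative[symmetric]
        using True assms by (auto intro!: derivative_eq_intros simp: field_simps)
    qed (auto intro!: continuous_intros)
    moreover have "F pi - F 0 = pi / 2"
      using sin_pi[of "n + m"] by (simp add: F_def)
    ultimately show ?thesis
      using True by simp
  next
    case False
    define F where "F = (\<lambda>u. sin ((real n - real m) * u) / (2 * (real n - real m))
                           - sin ((real n + real m) * u) / (2 * (real n + real m)))"
    have nm: "real n - real m \<noteq> 0" "real n + real m \<noteq> 0"
      using False assms by auto
    have "has_bochner_integral lborel (\<lambda>u. indicator {0..pi} u *\<^sub>R (sin (real n * u) * sin (real m * u)))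
            (F pi - F 0)"
      unfolding prod
    proof (rule has_bochner_integral_FTC_Icc)
      have cancel: "a * d / (2 * d) - b * e / (2 * e) = (a - b) / 2" if "d \<noteq> 0" "e \<noteq> 0" for a b d e :: real
        using that by (simp add: diff_divide_distrib)
      have "(F has_real_derivative (cos ((real n - real m) * u) * (real n - real m) / (2 * (real n - real m))
          - cos ((real n + real m) * u) * (real n + real m) / (2 * (real n + real m)))) (at u within {0..pi})" for u
        unfolding F_def by (rule derivative_eq_intros refl | use nm in simp)+
      thus "(F has_vector_derivative (cos ((real n - real m) * u) - cos ((real n + real m) * u)) / 2)
              (at u within {0..pi})" for u
        unfolding cancel[OF nm] has_real_derivative_iff_has_vector_derivative .
    qed (auto intro!: continuous_intros)
    moreover have "F pi - F 0 = 0"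
      using sin_pi[of "n + m"] sin_pi[of n] sin_pi[of m] by (simp add: F_def left_diff_distrib sin_diff)
    ultimately show ?thesis
      using False by simp
  qed
  thus ?thesis
    by (simp add: has_bochner_integral_iff)
qed

lemma integrable_pair_product_bound:
  fixes f :: "real \<Rightarrow> real \<Rightarrow> real"
  assumes [measurable]: "case_prod f \<in> borel_measurable (lborel \<Otimes>\<^sub>M lborel)"
    and A: "integrable lborel A" and B: "integrable lborel B"
    and le: "\<And>x y. \<bar>f x y\<bar> \<le> A x * B y"
  shows "integrable (lborel \<Otimes>\<^sub>M lborel) (case_prod f)"
proof (rule Bochner_Integration.integrable_bound)
  have [measurable]: "A \<in> borel_measurable borel" "B \<in> borel_measurable borel"
    using A B by (auto dest: borel_measurable_integrable)
  show "integrable (lborel \<Otimes>\<^sub>M lborel) (\<lambda>(x, y). A x * B y)"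
  proof (rule lborel_pair.Fubini_integrable)
    show "integrable lborel (\<lambda>x. \<integral>y. norm (case_prod (\<lambda>x y. A x * B y) (x, y)) \<partial>lborel)"
      using A by (simp add: abs_mult)
    show "AE x in lborel. integrable lborel (\<lambda>y. case_prod (\<lambda>x y. A x * B y) (x, y))"
      using B by simp
  qed measurable
  show "AE z in lborel \<Otimes>\<^sub>M lborel. norm (case_prod f z) \<le> norm (case z of (x, y) \<Rightarrow> A x * B y)"
    using le by (intro AE_I2) (auto intro: order.trans[OF le abs_ge_self])
qed measurable

lemma sine_kernel_macdonald_biorthogonal:
  assumes n: "n \<ge> 1" and m: "m \<ge> 1"
  shows "(\<integral>x. sine_kernel n x * (indicator {0<..} x * macdonald_moment 0 (real m) x) \<partial>lborel)
           = (if m = n then pi\<^sup>2 / sinh (pi * real n) else 0)"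
proof -
  define k where "k = (\<lambda>x. indicator {0<..} x * macdonald_moment 0 (real m) x)"
  define s where "s = (\<lambda>u. indicator {0..pi} u * (sinh u * sin (real n * u)))"
  define f where "f = (\<lambda>x u. s u * exp (- x * cosh u) * k x)"
  have [measurable]: "k \<in> borel_measurable borel" "s \<in> borel_measurable borel"
    unfolding k_def s_def by measurable
  obtain C where C: "C > 0" "\<And>m x. m \<ge> 1 \<Longrightarrow> x > 0 \<Longrightarrow>
    \<bar>macdonald_moment 0 (real m) x\<bar> \<le> C * exp (- pi * real m / 2) * exp (4 / 5 * x)"
    by (rule macdonald_moment_uniform_bound) blast
  have k_le: "\<bar>k x\<bar> \<le> C * (indicator {0<..} x * exp (4 / 5 * x))" for x
  proof (cases "x > 0")
    case True
    have "\<bar>macdonald_moment 0 (real m) x\<bar> \<le> C * exp (- pi * real m / 2) * exp (4 / 5 * x)"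
      by (rule C(2)[OF m True])
    also have "\<dots> \<le> C * 1 * exp (4 / 5 * x)"
      using C(1) by (intro mult_right_mono mult_left_mono) auto
    finally show ?thesis
      using True by (simp add: k_def)
  qed (simp add: k_def)
  have "integrable (lborel \<Otimes>\<^sub>M lborel) (case_prod f)"
  proof (rule integrable_pair_product_bound)
    show "integrable lborel (\<lambda>x. C * (indicator {0<..} x * exp (- x * (1 / 5))))"
      using has_bochner_integral_exp_decay[of "1/5"]
      by (intro integrable_mult_right) (simp add: has_bochner_integral_iff)
    show "integrable lborel (\<lambda>u. indicator {0..pi} u *\<^sub>R \<bar>sinh u\<bar>)"
      by (rule borel_integrable_compact) (auto intro!: continuous_intros)
    show "\<bar>f x u\<bar> \<le> C * (indicator {0<..} x * exp (- x * (1 / 5))) * (indicator {0..pi} u *\<^sub>R \<bar>sinh u\<bar>)" for x u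
    proof (cases "x > 0")
      case True
      have 1: "\<bar>s u\<bar> \<le> indicator {0..pi} u *\<^sub>R \<bar>sinh u\<bar>"
        by (simp add: s_def abs_mult indicator_def mult_left_le)
      have "x * 1 \<le> x * cosh u"
        using True cosh_real_ge_1[of u] by (intro mult_left_mono) auto
      hence 2: "exp (- x * cosh u) \<le> exp (- x)"
        by simp
      have "\<bar>f x u\<bar> = (exp (- x * cosh u) * \<bar>k x\<bar>) * \<bar>s u\<bar>"
        by (simp add: f_def abs_mult)
      also have "\<dots> \<le> (exp (- x) * (C * (indicator {0<..} x * exp (4 / 5 * x)))) * (indicator {0..pi} u *\<^sub>R \<bar>sinh u\<bar>)"
        using C(1) by (intro mult_mono 1 2 k_le) auto
      also have "exp (- x) * (C * (indicator {0<..} x * exp (4 / 5 * x)))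
                  = C * (indicator {0<..} x * (exp (- x) * exp (4 / 5 * x)))"
        by simp
      also have "exp (- x) * exp (4 / 5 * x) = exp (- x * (1 / 5))"
        unfolding exp_add[symmetric] by simp
      finally show ?thesis .
    qed (simp add: f_def k_def)
  qed (unfold f_def, measurable)
  hence "(\<integral>u. (\<integral>x. f x u \<partial>lborel) \<partial>lborel) = (\<integral>x. (\<integral>u. f x u \<partial>lborel) \<partial>lborel)"
    by (rule lborel_pair.Fubini_integral)
  also have "(\<lambda>x. \<integral>u. f x u \<partial>lborel) = (\<lambda>x. sine_kernel n x * k x)"
    unfolding f_def integral_mult_left_zero sine_kernel_def s_def ..
  also have "(\<lambda>u. \<integral>x. f x u \<partial>lborel)
      = (\<lambda>u. (2 * pi / sinh (pi * real m)) * (indicator {0..pi} u *\<^sub>R (sin (real n * u) * sin (real m * u))))"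
  proof
    fix u :: real
    have "f x u = s u * (exp (- x * cosh u) * k x)" for x
      by (simp add: f_def)
    hence *: "(\<integral>x. f x u \<partial>lborel) = s u * (\<integral>x. exp (- x * cosh u) * k x \<partial>lborel)"
      by (simp only: integral_mult_right_zero)
    show "(\<integral>x. f x u \<partial>lborel)
      = (2 * pi / sinh (pi * real m)) * (indicator {0..pi} u *\<^sub>R (sin (real n * u) * sin (real m * u)))"
    proof (cases "u > 0")
      case True
      \<comment> \<open>the factor \<open>sinh u\<close> of \<open>s\<close> cancels the denominator of the Laplace transform\<close>
      show ?thesis
        unfolding * k_def using True m by (subst laplace_transform_macdonald_moment) (auto simp: s_def)
    next
      case False
      thus ?thesis
        unfolding * s_def by (cases "u = 0") auto
    qed
  qed
  also have "(\<integral>u. (2 * pi / sinh (pi * real m)) * (indicator {0..pi} u *\<^sub>R (sin (real n * u) * sin (real m * u))) \<partial>lborel)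
      = (2 * pi / sinh (pi * real m)) * (if m = n then pi / 2 else 0)"
    unfolding integral_mult_right_zero integral_sin_mult_sin[OF n m] ..
  finally have "(\<integral>x. sine_kernel n x * k x \<partial>lborel) = (2 * pi / sinh (pi * real m)) * (if m = n then pi / 2 else 0)"
    by (rule sym)
  thus ?thesis
    unfolding k_def by (cases "m = n") (simp_all add: power2_eq_square)
qed

section \<open>The inversion formula\<close>

lemma integral_even_function:
  fixes f :: "real \<Rightarrow> real"
  assumes f: "integrable lborel f" and even: "\<And>u. f (- u) = f u"
  shows "(\<integral>u. indicator {0..} u * f u \<partial>lborel) = (\<integral>u. f u \<partial>lborel) / 2"
proof -
  define g where "g = (\<lambda>u. indicator {0..} u * f u)"
  have g: "integrable lborel g"
    unfolding g_def using integrable_mult_indicator[OF _ f, of "{0..}"] by simp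
  have g': "integrable lborel (\<lambda>u. g (- u))"
    using lborel_integrable_real_affine[OF g, of "-1" 0] by simp
  have "(\<integral>u. f u \<partial>lborel) = (\<integral>u. g u + g (- u) \<partial>lborel)"
  proof (rule integral_cong_AE)
    \<comment> \<open>the two sides differ at 0, where \<open>f\<close> is counted twice on the right\<close>
    show "AE u in lborel. f u = g u + g (- u)"
      using AE_lborel_singleton[of 0]
    proof eventually_elim
      case (elim u)
      thus ?case
        by (cases "u > 0") (auto simp: g_def even)
    qed
  qed (use f g g' in \<open>auto dest!: borel_measurable_integrable\<close>)
  also have "\<dots> = (\<integral>u. g u \<partial>lborel) + (\<integral>u. g (- u) \<partial>lborel)"
    by (rule Bochner_Integration.integral_add[OF g g'])
  also have "\<dots> = 2 * (\<integral>u. g u \<partial>lborel)"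
    by (simp add: integral_reflect)
  finally show ?thesis
    by (simp add: g_def)
qed

lemma macdonald_K_eq_moment:
  assumes x: "x > 0"
  shows "macdonald_K (\<i> * of_nat m) x = of_real (macdonald_moment 0 (real m) x / 2)"
proof -
  define f where "f = (\<lambda>u. (cosh u ^ 0 * cos (real m * u)) * exp (- x * cosh u))"
  have "cosh (\<i> * of_nat m * complex_of_real u) = of_real (cos (real m * u))" for u
    by (simp add: cosh_conv_cos cos_of_real[symmetric] algebra_simps)
  hence "macdonald_K (\<i> * of_nat m) x = (\<integral>u. complex_of_real (indicator {0..} u * f u) \<partial>lborel)"
    unfolding macdonald_K_def set_lebesgue_integral_def f_def
    by (intro Bochner_Integration.integral_cong) (auto simp: scaleR_conv_of_real)
  also have "\<dots> = of_real (\<integral>u. indicator {0..} u * f u \<partial>lborel)"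
    by (rule integral_complex_of_real)
  also have "(\<integral>u. indicator {0..} u * f u \<partial>lborel) = (\<integral>u. f u \<partial>lborel) / 2"
  proof (rule integral_even_function)
    show "integrable lborel f"
      unfolding f_def by (rule integrable_mult_exp_cosh[OF x _ abs_cosh_power_mult_cos_le]) measurable
  qed (simp add: f_def)
  also have "(\<integral>u. f u \<partial>lborel) = macdonald_moment 0 (real m) x"
    unfolding f_def by (rule macdonald_moment_eq_integral[OF x, symmetric])
  finally show ?thesis .
qed

theorem theorem1:
  fixes a :: "nat \<Rightarrow> complex" and n :: nat
  assumes "summable (\<lambda>m. cmod (a (Suc m)) * exp (- pi * real (Suc m) / 2))"
    and "n \<ge> 1"
  shows "(\<forall>x>0. summable (\<lambda>m. cmod (a (Suc m) * macdonald_K (\<i> * of_nat (Suc m)) x)))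
    \<and> set_integrable lborel {0<..}
        (\<lambda>x::real. cmod (incomplete_J (complex_of_real x) (\<i> * of_nat n) pi)
          * (\<Sum>m. cmod (a (Suc m) * macdonald_K (\<i> * of_nat (Suc m)) x)) / x)
    \<and> set_integrable lborel {0<..}
        (\<lambda>x::real. incomplete_J (complex_of_real x) (\<i> * of_nat n) pi
          * (\<Sum>m. a (Suc m) * macdonald_K (\<i> * of_nat (Suc m)) x) / complex_of_real x)
    \<and> a n = complex_of_real (2 / pi\<^sup>2 * real n * sinh (pi * real n))
        * (LINT x:{0<..}|lborel. incomplete_J (complex_of_real x) (\<i> * of_nat n) pi
            * (\<Sum>m. a (Suc m) * macdonald_K (\<i> * of_nat (Suc m)) x) / complex_of_real x)"
proof -
  let ?J = "\<lambda>x. incomplete_J (complex_of_real x) (\<i> * of_nat n) pi"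
  let ?K = "\<lambda>m x. a (Suc m) * macdonald_K (\<i> * of_nat (Suc m)) x"
  define w where "w = (\<lambda>m. cmod (a (Suc m)) * exp (- pi * real (Suc m) / 2))"
  have w: "summable w" "w m \<ge> 0" for m
    using assms(1) by (simp_all add: w_def)
  obtain C where C: "C > 0" "\<And>m x. m \<ge> 1 \<Longrightarrow> x > 0 \<Longrightarrow>
    \<bar>macdonald_moment 0 (real m) x\<bar> \<le> C * exp (- pi * real m / 2) * exp (4 / 5 * x)"
    by (rule macdonald_moment_uniform_bound) blast
  have K_le: "cmod (?K m x) \<le> w m * (C / 2 * exp (4 / 5 * x))" if x: "x > 0" for m x
  proof -
    have "cmod (?K m x) = cmod (a (Suc m)) * (\<bar>macdonald_moment 0 (real (Suc m)) x\<bar> / 2)"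
      unfolding macdonald_K_eq_moment[OF x] norm_mult norm_of_real by simp
    also have "\<dots> \<le> cmod (a (Suc m)) * ((C * exp (- pi * real (Suc m) / 2) * exp (4 / 5 * x)) / 2)"
      using x by (intro mult_left_mono divide_right_mono C(2)) auto
    finally show ?thesis
      by (simp add: w_def mult_ac)
  qed
  have summable_K: "summable (\<lambda>m. cmod (?K m x))" if x: "x > 0" for x
    by (rule summable_comparison_test'[OF summable_mult2[OF w(1), of "C / 2 * exp (4 / 5 * x)"], of 0])
      (simp only: real_norm_def abs_norm_cancel K_le[OF x])

  \<comment> \<open>the terms of the series under the integral sign, extended by zero to the real line\<close>
  define h where "h = (\<lambda>m x. indicator {0<..} x *\<^sub>R (?J x * ?K m x / complex_of_real x))"
  have J_x: "?J x / complex_of_real x = of_real (sine_kernel n x / real n)" if "x > 0" for x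
    using that by (simp add: incomplete_J_eq_sine_kernel[OF assms(2)])
  have h_eq: "h m x = a (Suc m) / of_nat (2 * n) *
      complex_of_real (sine_kernel n x * (indicator {0<..} x * macdonald_moment 0 (real (Suc m)) x))" for m x
  proof (cases "x > 0")
    case True
    have "h m x = ?J x / complex_of_real x * ?K m x"
      using True by (simp add: h_def)
    also have "\<dots> = of_real (sine_kernel n x / real n) *
                      (a (Suc m) * of_real (macdonald_moment 0 (real (Suc m)) x / 2))"
      unfolding J_x[OF True] macdonald_K_eq_moment[OF True] ..
    finally show ?thesis
      using True by (simp add: mult_ac)
  qed (simp add: h_def)
  \<comment> \<open>the decay \<open>exp (- x)\<close> of \<open>J / x\<close> beats the growth \<open>exp (4 / 5 * x)\<close> of the Macdonald bound\<close>
  define B where "B = (\<lambda>x. pi * cosh pi * (C / 2) * (indicator {0<..} x * exp (- x * (1 / 5))))"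
  have intB: "integrable lborel B"
    unfolding B_def using has_bochner_integral_exp_decay[of "1/5"]
    by (intro integrable_mult_right) (simp add: has_bochner_integral_iff)
  have h_le: "cmod (h m x) \<le> w m * B x" for m x
  proof (cases "x > 0")
    case True
    have n1: "real n \<ge> 1"
      using assms(2) by simp
    have "cmod (h m x) = cmod (?J x / complex_of_real x) * cmod (?K m x)"
      using True by (simp add: h_def norm_mult norm_divide)
    also have "cmod (?J x / complex_of_real x) = \<bar>sine_kernel n x\<bar> / real n"
      unfolding J_x[OF True] norm_of_real by simp
    also have "\<dots> \<le> \<bar>sine_kernel n x\<bar> / 1"
      using n1 by (intro divide_left_mono) auto
    also have "\<dots> \<le> pi * cosh pi * exp (- x)"
      using abs_sine_kernel_le[of x n] True by simp
    also have "pi * cosh pi * exp (- x) * cmod (?K m x)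
        \<le> pi * cosh pi * exp (- x) * (w m * (C / 2 * exp (4 / 5 * x)))"
      by (intro mult_left_mono K_le True) auto
    also have "\<dots> = w m * (pi * cosh pi * (C / 2) * (exp (- x) * exp (4 / 5 * x)))"
      by simp
    also have "exp (- x) * exp (4 / 5 * x) = exp (- x * (1 / 5))"
      unfolding exp_add[symmetric] by simp
    finally show ?thesis
      using True by (simp add: B_def mult_right_mono)
  qed (simp add: h_def B_def)
  have [measurable]: "h m \<in> borel_measurable borel" for m
    unfolding h_eq by measurable
  have int_h: "integrable lborel (h m)" for m
  proof (rule Bochner_Integration.integrable_bound)
    show "integrable lborel (\<lambda>x. w m * B x)"
      using intB by (rule integrable_mult_right)
    show "AE x in lborel. cmod (h m x) \<le> norm (w m * B x)"
      by (intro AE_I2 order.trans[OF h_le]) simp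
  qed measurable
  have summable_h: "summable (\<lambda>m. cmod (h m x))" for x
    by (rule summable_comparison_test'[OF summable_mult2[OF w(1), of "B x"], of 0])
      (simp only: real_norm_def abs_norm_cancel h_le)
  have summable_int: "summable (\<lambda>m. \<integral>x. cmod (h m x) \<partial>lborel)"
  proof (rule summable_comparison_test'[OF summable_mult2[OF w(1), of "\<integral>x. B x \<partial>lborel"], of 0])
    fix m
    have "(\<integral>x. cmod (h m x) \<partial>lborel) \<le> (\<integral>x. w m * B x \<partial>lborel)"
      using intB int_h by (intro integral_mono h_le) auto
    thus "norm (\<integral>x. cmod (h m x) \<partial>lborel) \<le> w m * (\<integral>x. B x \<partial>lborel)"
      by simp
  qed

  have norm_sum: "indicator {0<..} x *\<^sub>R (cmod (?J x) * (\<Sum>m. cmod (?K m x)) / x) = (\<Sum>m. norm (cmod (h m x)))" for x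
  proof (cases "x > 0")
    case True
    have "(\<Sum>m. norm (cmod (h m x))) = (\<Sum>m. cmod (?J x) / x * cmod (?K m x))"
      using True by (simp add: h_def norm_mult norm_divide)
    also have "\<dots> = cmod (?J x) / x * (\<Sum>m. cmod (?K m x))"
      by (rule suminf_mult[OF summable_K[OF True]])
    finally show ?thesis
      using True by simp
  qed (simp add: h_def)
  have sum: "indicator {0<..} x *\<^sub>R (?J x * (\<Sum>m. ?K m x) / complex_of_real x) = (\<Sum>m. h m x)" for x
  proof (cases "x > 0")
    case True
    have "(\<Sum>m. h m x) = (\<Sum>m. ?J x / complex_of_real x * ?K m x)"
      using True by (simp add: h_def)
    also have "\<dots> = ?J x / complex_of_real x * (\<Sum>m. ?K m x)"
      by (rule suminf_mult[OF summable_norm_cancel[OF summable_K[OF True]]])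
    finally show ?thesis
      using True by simp
  qed (simp add: h_def)

  have int_norm: "integrable lborel (\<lambda>x. \<Sum>m. norm (cmod (h m x)))"
  proof -
    have "integrable lborel (\<lambda>x. \<Sum>m. cmod (h m x))"
      by (rule integrable_suminf) (use int_h summable_h summable_int in auto)
    thus ?thesis by simp
  qed
  have int_sum: "integrable lborel (\<lambda>x. \<Sum>m. h m x)"
    by (rule integrable_suminf) (use int_h summable_h summable_int in auto)
  have "(\<integral>x. (\<Sum>m. h m x) \<partial>lborel) = (\<Sum>m. \<integral>x. h m x \<partial>lborel)"
    by (rule integral_suminf) (use int_h summable_h summable_int in auto)
  also have "(\<lambda>m. \<integral>x. h m x \<partial>lborel)
      = (\<lambda>m. if m = n - 1 then a n / of_nat (2 * n) * of_real (pi\<^sup>2 / sinh (pi * real n)) else 0)"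
  proof
    fix m
    have "(\<integral>x. h m x \<partial>lborel) = a (Suc m) / of_nat (2 * n) *
        of_real (\<integral>x. sine_kernel n x * (indicator {0<..} x * macdonald_moment 0 (real (Suc m)) x) \<partial>lborel)"
      unfolding h_eq integral_mult_right_zero integral_complex_of_real ..
    also have "\<dots> = a (Suc m) / of_nat (2 * n) *
        of_real (if Suc m = n then pi\<^sup>2 / sinh (pi * real n) else 0)"
      by (subst sine_kernel_macdonald_biorthogonal[OF assms(2)]) auto
    also have "\<dots> = (if m = n - 1 then a n / of_nat (2 * n) * of_real (pi\<^sup>2 / sinh (pi * real n)) else 0)"
      using assms(2) by (auto split: if_splits)
    finally show "(\<integral>x. h m x \<partial>lborel) = \<dots>" .
  qed
  also have "(\<Sum>m. if m = n - 1 then a n / of_nat (2 * n) * of_real (pi\<^sup>2 / sinh (pi * real n)) else 0)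
      = a n / of_nat (2 * n) * of_real (pi\<^sup>2 / sinh (pi * real n))"
    using sums_single[of "n - 1" "\<lambda>_. a n / of_nat (2 * n) * complex_of_real (pi\<^sup>2 / sinh (pi * real n))"]
    by (rule sums_unique[symmetric])
  finally have integral: "(LINT x:{0<..}|lborel. ?J x * (\<Sum>m. ?K m x) / complex_of_real x)
      = a n / of_nat (2 * n) * of_real (pi\<^sup>2 / sinh (pi * real n))"
    unfolding set_lebesgue_integral_def sum .
  have "sinh (pi * real n) \<noteq> 0" "real n \<noteq> 0"
    using assms(2) by auto
  hence "a n = complex_of_real (2 / pi\<^sup>2 * real n * sinh (pi * real n))
          * (LINT x:{0<..}|lborel. ?J x * (\<Sum>m. ?K m x) / complex_of_real x)"
    unfolding integral by (simp add: field_simps)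
  thus ?thesis
    using summable_K int_norm int_sum unfolding set_integrable_def norm_sum sum by blast
qed

end
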